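(* Let $A$ be a Nakayama algebra over a field $k$ with resolution quiver $R_A$. The following two criteria for $A$ to have finite global dimension are equivalent to each other: (i) there is a cyclic vertex $a$ in $R_A$ such that the simple module $S_a$ has even injective dimension (in particular finite); (ii) $R_A$ is connected of weight $1$.
   Context: Fix a field $k$; all modules are finite dimensional right modules. Let $\Delta_n$ ($n\ge 1$) be the cyclic quiver with vertices $1,\dots,n$ and arrows $x_a\colon a\to a+1$ for $1\le a\le n-1$ and $x_n\colon n\to 1$. A Nakayama algebra of order $n$ is a finite dimensional algebra $A$ isomorphic to the quotient of the path algebra $k\Delta_n$ by an ideal generated by a finite set of nontrivial paths (arrows are allowed in this set). For a vertex $a$, let $e_a$ be the idempotent, $S_a$ the simple module and $P_a=e_aA$ the indecomposable projective module at $a$; paths are composed so that $e_aA$ is spanned by the paths starting at $a$. Put $p_a=\dim_k P_a$. Let $\tau(a)=a+1$ for $1\le a\le n-1$ and $\tau(n)=1$. The resolution quiver $R_A$ has vertices $1,\dots,n$ (identified with $S_1,\dots,S_n$) and a unique arrow $a\to\gamma(a)$ for each $a$, where $\gamma(a)=\tau^{p_a}(a)$. A vertex is cyclic if it lies on a cycle of $R_A$. The weight of a cycle $I$ is $w=\frac1n\sum_{a\in I}p_a$; it is an integer independent of the cycle chosen and is called the weight of $R_A$. *)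

theory Defs
  imports Complex_Main "HOL-Library.Function_Algebras" "HOL-Library.Extended_Nat"
begin

section \<open>The cyclic quiver and its path algebra\<close>

definition verts :: "nat \<Rightarrow> nat set" where
  "verts n = {1..n}"

definition rot :: "nat \<Rightarrow> nat \<Rightarrow> nat" where
  "rot n a = (if a = n then 1 else a + 1)"

text \<open>Every vertex of the cyclic quiver has exactly one outgoing arrow, so a path is determined by
  its starting vertex \<open>a\<close> and its length \<open>l\<close>; it ends at \<open>(rot n ^^ l) a\<close>. We write it \<open>(a, l)\<close>.\<close>

definition quiver_paths :: "nat \<Rightarrow> (nat \<times> nat) set" where
  "quiver_paths n = verts n \<times> UNIV"

text \<open>Elements of the path algebra are the finitely supported coefficient functions on paths.
  Addition and subtraction are pointwise.\<close>

definition path_algebra :: "nat \<Rightarrow> (nat \<times> nat \<Rightarrow> 'k::field) set" where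
  "path_algebra n = {f. finite {p. f p \<noteq> 0} \<and> {p. f p \<noteq> 0} \<subseteq> quiver_paths n}"

definition path_vec :: "nat \<times> nat \<Rightarrow> (nat \<times> nat \<Rightarrow> 'k::field)" where
  "path_vec p = (\<lambda>q. if q = p then 1 else 0)"

definition path_scale :: "'k::field \<Rightarrow> (nat \<times> nat \<Rightarrow> 'k) \<Rightarrow> (nat \<times> nat \<Rightarrow> 'k)" where
  "path_scale c f = (\<lambda>p. c * f p)"

text \<open>The coefficient of \<open>f g\<close> at the path \<open>(a, l)\<close> sums over all factorisations of that path into
  \<open>(a, i)\<close> followed by \<open>((rot n ^^ i) a, l - i)\<close>.\<close>

definition path_mult ::
    "nat \<Rightarrow> (nat \<times> nat \<Rightarrow> 'k::field) \<Rightarrow> (nat \<times> nat \<Rightarrow> 'k) \<Rightarrow> (nat \<times> nat \<Rightarrow> 'k)" where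
  "path_mult n f g = (\<lambda>(a, l). \<Sum>i\<le>l. f (a, i) * g ((rot n ^^ i) a, l - i))"

definition path_one :: "nat \<Rightarrow> (nat \<times> nat \<Rightarrow> 'k::field)" where
  "path_one n = (\<Sum>a\<in>verts n. path_vec (a, 0))"

lemma path_mult_path_vec:
  "path_mult n (path_vec (a, l)) (path_vec (b, m)) =
     (if (rot n ^^ l) a = b then path_vec (a, l + m) else (0 :: nat \<times> nat \<Rightarrow> 'k::field))"
proof (rule ext, clarify)
  fix c k
  have "path_mult n (path_vec (a, l)) (path_vec (b, m)) (c, k) =
      (\<Sum>i\<le>k. if i = l then (if c = a \<and> (rot n ^^ l) a = b \<and> k - l = m then 1 else 0) else (0::'k))"
    unfolding path_mult_def path_vec_def prod.case by (rule sum.cong) auto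
  also have "\<dots> = (if l \<le> k \<and> c = a \<and> (rot n ^^ l) a = b \<and> k - l = m then 1 else 0)"
    by (subst sum.delta) auto
  finally show "path_mult n (path_vec (a, l)) (path_vec (b, m)) (c, k) =
      (if (rot n ^^ l) a = b then path_vec (a, l + m) else (0 :: nat \<times> nat \<Rightarrow> 'k)) (c, k)"
    by (auto simp: path_vec_def)
qed

definition two_sided_ideal :: "nat \<Rightarrow> (nat \<times> nat \<Rightarrow> 'k::field) set \<Rightarrow> bool" where
  "two_sided_ideal n I \<longleftrightarrow>
     I \<subseteq> path_algebra n \<and> 0 \<in> I \<and> (\<forall>x\<in>I. \<forall>y\<in>I. x - y \<in> I) \<and>
     (\<forall>x\<in>I. \<forall>r\<in>path_algebra n. path_mult n r x \<in> I \<and> path_mult n x r \<in> I)"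

definition ideal_generated :: "nat \<Rightarrow> (nat \<times> nat \<Rightarrow> 'k::field) set \<Rightarrow> (nat \<times> nat \<Rightarrow> 'k) set" where
  "ideal_generated n S = \<Inter>{I. two_sided_ideal n I \<and> S \<subseteq> I}"


section \<open>Finite dimensional algebras and Nakayama algebras\<close>

definition fd_algebra :: "('k::field \<Rightarrow> 'a::ring_1 \<Rightarrow> 'a) \<Rightarrow> bool" where
  "fd_algebra scale \<longleftrightarrow>
     vector_space scale \<and>
     (\<forall>c x y. scale c x * y = scale c (x * y) \<and> x * scale c y = scale c (x * y)) \<and>
     (\<exists>B. finite B \<and> module.span scale B = UNIV)"

definition path_algebra_hom ::
    "nat \<Rightarrow> ('k::field \<Rightarrow> 'a::ring_1 \<Rightarrow> 'a) \<Rightarrow> ((nat \<times> nat \<Rightarrow> 'k) \<Rightarrow> 'a) \<Rightarrow> bool" where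
  "path_algebra_hom n scale \<pi> \<longleftrightarrow>
     (\<forall>x\<in>path_algebra n. \<forall>y\<in>path_algebra n.
        \<pi> (x + y) = \<pi> x + \<pi> y \<and> \<pi> (path_mult n x y) = \<pi> x * \<pi> y) \<and>
     (\<forall>c. \<forall>x\<in>path_algebra n. \<pi> (path_scale c x) = scale c (\<pi> x)) \<and>
     \<pi> (path_one n) = 1"

text \<open>An isomorphism between the quotient of the path algebra by the ideal generated by the finite
  set \<open>R\<close> of nontrivial paths and the algebra \<open>'a\<close> is given as a surjective homomorphism \<open>\<pi>\<close> from
  the path algebra whose kernel is that ideal.\<close>

definition nakayama_algebra ::
    "nat \<Rightarrow> (nat \<times> nat) set \<Rightarrow> ('k::field \<Rightarrow> 'a::ring_1 \<Rightarrow> 'a) \<Rightarrow> ((nat \<times> nat \<Rightarrow> 'k) \<Rightarrow> 'a) \<Rightarrow> bool"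
  where
  "nakayama_algebra n R scale \<pi> \<longleftrightarrow>
     n \<ge> 1 \<and> fd_algebra scale \<and>
     finite R \<and> R \<subseteq> quiver_paths n \<and> (\<forall>(a, l)\<in>R. l \<ge> 1) \<and>
     path_algebra_hom n scale \<pi> \<and> \<pi> ` path_algebra n = UNIV \<and>
     {x \<in> path_algebra n. \<pi> x = 0} = ideal_generated n (path_vec ` R)"

definition idem :: "((nat \<times> nat \<Rightarrow> 'k::field) \<Rightarrow> 'a::ring_1) \<Rightarrow> nat \<Rightarrow> 'a" where
  "idem \<pi> a = \<pi> (path_vec (a, 0))"

definition dim_proj ::
    "('k::field \<Rightarrow> 'a::ring_1 \<Rightarrow> 'a) \<Rightarrow> ((nat \<times> nat \<Rightarrow> 'k) \<Rightarrow> 'a) \<Rightarrow> nat \<Rightarrow> nat" where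
  "dim_proj scale \<pi> a = vector_space.dim scale (range (\<lambda>x. idem \<pi> a * x))"


section \<open>Finite dimensional right modules\<close>

text \<open>The space of all sequences over \<open>k\<close> with pointwise operations contains an isomorphic copy of
  every finite dimensional vector space. The underlying spaces of modules are its finite dimensional
  subspaces, so that every finite dimensional module is isomorphic to one considered here.\<close>

definition seq_scale :: "'k::field \<Rightarrow> (nat \<Rightarrow> 'k) \<Rightarrow> (nat \<Rightarrow> 'k)" where
  "seq_scale c v = (\<lambda>i. c * v i)"

global_interpretation seq: vector_space "seq_scale :: 'k::field \<Rightarrow> _"
  by unfold_locales (auto simp: seq_scale_def fun_eq_iff algebra_simps)

record ('k, 'a) rmod =
  carrier :: "(nat \<Rightarrow> 'k) set"
  act :: "(nat \<Rightarrow> 'k) \<Rightarrow> 'a \<Rightarrow> (nat \<Rightarrow> 'k)"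

definition fd_module :: "('k::field \<Rightarrow> 'a::ring_1 \<Rightarrow> 'a) \<Rightarrow> ('k, 'a) rmod \<Rightarrow> bool" where
  "fd_module scale M \<longleftrightarrow>
     seq.subspace (carrier M) \<and>
     (\<exists>B. finite B \<and> carrier M = seq.span B) \<and>
     (\<forall>v\<in>carrier M. \<forall>x. act M v x \<in> carrier M) \<and>
     (\<forall>v\<in>carrier M. \<forall>w\<in>carrier M. \<forall>x. act M (v + w) x = act M v x + act M w x) \<and>
     (\<forall>v\<in>carrier M. \<forall>x y. act M v (x + y) = act M v x + act M v y) \<and>
     (\<forall>v\<in>carrier M. \<forall>x y. act M v (x * y) = act M (act M v x) y) \<and>
     (\<forall>v\<in>carrier M. act M v 1 = v) \<and>
     (\<forall>v\<in>carrier M. \<forall>c x. act M v (scale c x) = seq_scale c (act M v x))"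

definition mod_hom ::
    "('k::field, 'a) rmod \<Rightarrow> ('k, 'a) rmod \<Rightarrow> ((nat \<Rightarrow> 'k) \<Rightarrow> (nat \<Rightarrow> 'k)) \<Rightarrow> bool" where
  "mod_hom M N f \<longleftrightarrow>
     f ` carrier M \<subseteq> carrier N \<and>
     (\<forall>v\<in>carrier M. \<forall>w\<in>carrier M. f (v + w) = f v + f w) \<and>
     (\<forall>v\<in>carrier M. \<forall>x. f (act M v x) = act N (f v) x)"

definition injective_module :: "('k::field \<Rightarrow> 'a::ring_1 \<Rightarrow> 'a) \<Rightarrow> ('k, 'a) rmod \<Rightarrow> bool" where
  "injective_module scale M \<longleftrightarrow>
     fd_module scale M \<and>
     (\<forall>X Y i g. fd_module scale X \<and> fd_module scale Y \<and>
        mod_hom X Y i \<and> inj_on i (carrier X) \<and> mod_hom X M g \<longrightarrow>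
        (\<exists>h. mod_hom Y M h \<and> (\<forall>v\<in>carrier X. h (i v) = g v)))"

text \<open>An exact sequence \<open>0 \<rightarrow> M \<rightarrow> I 0 \<rightarrow> \<dots> \<rightarrow> I d \<rightarrow> 0\<close> with all \<open>I j\<close> injective. The maps are
  \<open>\<eta> : M \<rightarrow> I 0\<close> and \<open>f j : I j \<rightarrow> I (j + 1)\<close> for \<open>j < d\<close>; the zero map \<open>f d\<close> stands for
  \<open>I d \<rightarrow> 0\<close>.\<close>

definition injective_resolution ::
    "('k::field \<Rightarrow> 'a::ring_1 \<Rightarrow> 'a) \<Rightarrow> ('k, 'a) rmod \<Rightarrow> nat \<Rightarrow> (nat \<Rightarrow> ('k, 'a) rmod) \<Rightarrow>
     ((nat \<Rightarrow> 'k) \<Rightarrow> (nat \<Rightarrow> 'k)) \<Rightarrow> (nat \<Rightarrow> (nat \<Rightarrow> 'k) \<Rightarrow> (nat \<Rightarrow> 'k)) \<Rightarrow> bool" where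
  "injective_resolution scale M d I \<eta> f \<longleftrightarrow>
     (\<forall>j\<le>d. injective_module scale (I j)) \<and>
     mod_hom M (I 0) \<eta> \<and> inj_on \<eta> (carrier M) \<and>
     (\<forall>j<d. mod_hom (I j) (I (Suc j)) (f j)) \<and>
     (\<forall>v\<in>carrier (I d). f d v = 0) \<and>
     \<eta> ` carrier M = {v \<in> carrier (I 0). f 0 v = 0} \<and>
     (\<forall>j<d. f j ` carrier (I j) = {v \<in> carrier (I (Suc j)). f (Suc j) v = 0})"

definition injective_dimension :: "('k::field \<Rightarrow> 'a::ring_1 \<Rightarrow> 'a) \<Rightarrow> ('k, 'a) rmod \<Rightarrow> enat" where
  "injective_dimension scale M = Inf {enat d | d. \<exists>I \<eta> f. injective_resolution scale M d I \<eta> f}"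

definition simple_module :: "('k::field \<Rightarrow> 'a::ring_1 \<Rightarrow> 'a) \<Rightarrow> ('k, 'a) rmod \<Rightarrow> bool" where
  "simple_module scale S \<longleftrightarrow>
     fd_module scale S \<and> carrier S \<noteq> {0} \<and>
     (\<forall>N \<subseteq> carrier S. seq.subspace N \<and> (\<forall>v\<in>N. \<forall>x. act S v x \<in> N) \<longrightarrow> N = {0} \<or> N = carrier S)"

text \<open>The simple module at a vertex is determined only up to isomorphism: it is the simple
  module on which the idempotent of that vertex does not act as zero.\<close>

definition simple_at ::
    "('k::field \<Rightarrow> 'a::ring_1 \<Rightarrow> 'a) \<Rightarrow> ((nat \<times> nat \<Rightarrow> 'k) \<Rightarrow> 'a) \<Rightarrow> nat \<Rightarrow> ('k, 'a) rmod \<Rightarrow> bool"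
  where
  "simple_at scale \<pi> a S \<longleftrightarrow>
     simple_module scale S \<and> (\<exists>v\<in>carrier S. act S v (idem \<pi> a) \<noteq> 0)"


section \<open>The resolution quiver\<close>

text \<open>Here \<open>p\<close> is the function sending a vertex \<open>a\<close> to the dimension of the indecomposable projective
  module at \<open>a\<close>.\<close>

definition res_map :: "nat \<Rightarrow> (nat \<Rightarrow> nat) \<Rightarrow> nat \<Rightarrow> nat" where
  "res_map n p a = (rot n ^^ p a) a"

definition res_arrows :: "nat \<Rightarrow> (nat \<Rightarrow> nat) \<Rightarrow> (nat \<times> nat) set" where
  "res_arrows n p = {(a, res_map n p a) | a. a \<in> verts n}"

definition cyclic_vertex :: "nat \<Rightarrow> (nat \<Rightarrow> nat) \<Rightarrow> nat \<Rightarrow> bool" where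
  "cyclic_vertex n p a \<longleftrightarrow> a \<in> verts n \<and> (a, a) \<in> (res_arrows n p)\<^sup>+"

text \<open>As there is one arrow out of each vertex, the cycle through a cyclic vertex consists of the
  vertices reachable from it. A cycle is identified with its vertex set.\<close>

definition res_cycle :: "nat \<Rightarrow> (nat \<Rightarrow> nat) \<Rightarrow> nat set \<Rightarrow> bool" where
  "res_cycle n p I \<longleftrightarrow> (\<exists>a. cyclic_vertex n p a \<and> I = {b. (a, b) \<in> (res_arrows n p)\<^sup>*})"

definition cycle_weight :: "nat \<Rightarrow> (nat \<Rightarrow> nat) \<Rightarrow> nat set \<Rightarrow> rat" where
  "cycle_weight n p I = of_nat (\<Sum>a\<in>I. p a) / of_nat n"

definition res_weight :: "nat \<Rightarrow> (nat \<Rightarrow> nat) \<Rightarrow> rat" where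
  "res_weight n p = (THE w. \<exists>I. res_cycle n p I \<and> w = cycle_weight n p I)"

definition res_connected :: "nat \<Rightarrow> (nat \<Rightarrow> nat) \<Rightarrow> bool" where
  "res_connected n p \<longleftrightarrow>
     (\<forall>a\<in>verts n. \<forall>b\<in>verts n. (a, b) \<in> (res_arrows n p \<union> (res_arrows n p)\<inverse>)\<^sup>*)"

end

theory Submission
  imports Defs "HOL-Library.Nat_Bijection"
begin

text \<open>Unroll the cyclic quiver to the integers and put \<open>F t = t + p\<^sub>t\<close>. The indecomposable modules are the
  intervals \<open>[i, j)\<close> with \<open>i < j \<le> F i\<close>, the simple module at \<open>t\<close> is \<open>[t, t + 1)\<close>, and \<open>[i, j)\<close> is
  injective iff \<open>i = G j\<close> for the left adjoint \<open>G\<close> of the monotone map \<open>F\<close>. The cosyzygy of \<open>[i, j)\<close> is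
  \<open>[G j, i)\<close>, so the cosyzygies of \<open>[t, t + 1)\<close> of degrees \<open>2 m\<close> and \<open>2 m + 1\<close> are
  \<open>[G\<^sup>m t, G\<^sup>m (t + 1))\<close> and \<open>[G\<^sup>m\<^sup>+\<^sup>1 (t + 1), G\<^sup>m t)\<close>. At a cyclic vertex those of even degree never
  vanish, hence the injective dimension is even as soon as it is finite. By adjunction it is at most
  \<open>2 m\<close> iff \<open>F\<^sup>m\<^sup>+\<^sup>1 k > t\<close> implies \<open>F\<^sup>m k \<ge> t\<close>. On the cyclic positions \<open>F\<close> is an order automorphism,
  and for large \<open>m\<close> this condition says that it sends every cyclic position to the next one, which is
  connectedness together with weight one.\<close>

section \<open>The resolution quiver on the integers\<close>

text \<open>By adjunction \<open>[G^(m+1) (t + 1), G^m t)\<close> is empty iff every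
  \<open>k\<close> with \<open>t + 1 \<le> F^(m+1) k\<close> satisfies \<open>t \<le> F^m k\<close>.
  At a cyclic position \<open>t = F^m k\<close> for some \<open>k\<close>, and then
  \<open>G^m t \<le> k < G^m (t + 1)\<close>, so the cosyzygies of even degree survive. The obstacle
  is that the injective dimension ranges over all resolutions by arbitrary modules. The lower bound
  therefore tests with extensions: \<open>[y0, y1)\<close> has a projective resolution with terms at
  the positions \<open>y0, y1, F y0, F y1, ...\<close>, and a dimension shift along any injective
  resolution of \<open>S\<close> of length \<open>d\<close> makes the resulting complex exact in
  degree \<open>d + 1\<close>. Only the upper bound writes down cosyzygies.\<close>

definition vx :: "nat \<Rightarrow> int \<Rightarrow> nat" where
  "vx n t = nat ((t - 1) mod int n) + 1"

lemma vx_in_verts: "n \<ge> 1 \<Longrightarrow> vx n t \<in> verts n"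
  using pos_mod_bound[of "int n" "t - 1"] pos_mod_sign[of "int n" "t - 1"]
  unfolding vx_def verts_def atLeastAtMost_iff by linarith

lemma vx_eq_iff: "n \<ge> 1 \<Longrightarrow> vx n s = vx n t \<longleftrightarrow> int n dvd s - t"
proof -
  assume n: "n \<ge> 1"
  have "vx n s = vx n t \<longleftrightarrow> (s - 1) mod int n = (t - 1) mod int n"
    using n by (simp add: vx_def eq_nat_nat_iff)
  also have "\<dots> \<longleftrightarrow> int n dvd s - t" by (simp add: mod_eq_dvd_iff)
  finally show ?thesis .
qed

lemma vx_of_nat: "a \<in> verts n \<Longrightarrow> vx n (int a) = a"
  by (auto simp: vx_def verts_def)

lemma rot_vx: "n \<ge> 1 \<Longrightarrow> rot n (vx n t) = vx n (t + 1)"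
proof -
  assume n: "n \<ge> 1"
  have v: "vx n t \<in> verts n" using n by (rule vx_in_verts)
  then have r: "rot n (vx n t) \<in> verts n" using n by (auto simp: rot_def verts_def)
  have 1: "int n dvd int (vx n t) - t"
    using vx_of_nat[OF v] vx_eq_iff[OF n] by metis
  have "int n dvd int (rot n (vx n t)) - (int (vx n t) + 1)" by (auto simp: rot_def)
  with 1 have "int n dvd (int (rot n (vx n t)) - (int (vx n t) + 1)) + (int (vx n t) - t)"
    by (rule dvd_add[rotated])
  then have "int n dvd int (rot n (vx n t)) - (t + 1)" by (simp add: algebra_simps)
  then show ?thesis using vx_eq_iff[OF n] vx_of_nat[OF r] by metis
qed

lemma rot_pow_vx: "n \<ge> 1 \<Longrightarrow> (rot n ^^ l) (vx n t) = vx n (t + int l)"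
  by (induction l) (auto simp: rot_vx algebra_simps)

text \<open>The axioms on \<open>p\<close> are those of a Kupisch series. The last one says that
  \<open>F\<close> is monotone; it reflects that the radical of \<open>P_a\<close> is a quotient of
  the projective module at the next vertex.\<close>

locale cyclic_lengths =
  fixes n :: nat and p :: "nat \<Rightarrow> nat"
  assumes n_pos: "n \<ge> 1"
    and p_pos: "a \<in> verts n \<Longrightarrow> p a \<ge> 1"
    and p_rot: "a \<in> verts n \<Longrightarrow> p a \<le> p (rot n a) + 1"
begin

definition F :: "int \<Rightarrow> int" where
  "F t = t + int (p (vx n t))"

lemma vx_add_mult: "vx n (t + int n * z) = vx n t"
  by (simp add: vx_eq_iff[OF n_pos])

lemma F_add_mult: "F (t + int n * z) = F t + int n * z"
  by (simp add: F_def vx_add_mult)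

lemma F_gt: "t < F t"
  using p_pos[OF vx_in_verts[OF n_pos]] by (simp add: F_def Suc_le_eq)

lemma F_mono: "mono F"
proof (rule monoI)
  have step: "F t \<le> F (t + 1)" for t
    using p_rot[OF vx_in_verts[OF n_pos, of t]] rot_vx[OF n_pos, of t] by (simp add: F_def)
  fix s t :: int assume "s \<le> t"
  then show "F s \<le> F t"
    by (induction t rule: int_ge_induct) (use step order_trans in blast)+
qed

lemma Fp_mono: "s \<le> t \<Longrightarrow> (F ^^ k) s \<le> (F ^^ k) t"
  using funpow_mono[OF F_mono] .

lemma Fp_add_mult: "(F ^^ k) (t + int n * z) = (F ^^ k) t + int n * z"
  by (induction k) (auto simp: F_add_mult)

lemma Fp_less: "i < j \<Longrightarrow> (F ^^ i) t < (F ^^ j) t"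
proof (induction j)
  case (Suc j)
  then show ?case using F_gt[of "(F ^^ j) t"] by (cases "i = j") auto
qed simp

lemma Fp_le: "i \<le> j \<Longrightarrow> (F ^^ i) t \<le> (F ^^ j) t"
  using Fp_less[of i j t] by (cases "i = j") auto

lemma Fp_less_iff: "(F ^^ i) t < (F ^^ j) t \<longleftrightarrow> i < j"
  using Fp_less[of i j t] Fp_le[of j i t] by (meson leD linorder_not_le)

lemma Fp_ge: "t + int k \<le> (F ^^ k) t"
proof (induction k)
  case (Suc k)
  then show ?case using F_gt[of "(F ^^ k) t"] by simp
qed simp

lemma res_map_vx: "res_map n p (vx n t) = vx n (F t)"
  unfolding res_map_def rot_pow_vx[OF n_pos] F_def ..

lemma res_map_pow_vx: "(res_map n p ^^ k) (vx n t) = vx n ((F ^^ k) t)"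
  by (induction k) (auto simp: res_map_vx)

lemma res_arrow_iff: "(a, b) \<in> res_arrows n p \<longleftrightarrow> a \<in> verts n \<and> b = res_map n p a"
  by (auto simp: res_arrows_def)

lemma res_reach_iff:
  "(vx n t, b) \<in> (res_arrows n p)\<^sup>* \<longleftrightarrow> (\<exists>k. b = vx n ((F ^^ k) t))"
proof
  assume "(vx n t, b) \<in> (res_arrows n p)\<^sup>*"
  then show "\<exists>k. b = vx n ((F ^^ k) t)"
  proof induction
    case base
    show ?case by (rule exI[of _ 0]) simp
  next
    case (step y z)
    then obtain k where "y = vx n ((F ^^ k) t)" by auto
    then have "z = vx n ((F ^^ Suc k) t)" using step by (simp add: res_arrow_iff res_map_vx)
    then show ?case by blast
  qed
next
  have "(vx n t, vx n ((F ^^ k) t)) \<in> (res_arrows n p)\<^sup>*" for k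
  proof (induction k)
    case (Suc k)
    have "(vx n ((F ^^ k) t), vx n ((F ^^ Suc k) t)) \<in> res_arrows n p"
      using vx_in_verts[OF n_pos] by (simp add: res_arrow_iff res_map_vx)
    with Suc show ?case by (rule rtrancl_into_rtrancl)
  qed simp
  then show "\<exists>k. b = vx n ((F ^^ k) t) \<Longrightarrow> (vx n t, b) \<in> (res_arrows n p)\<^sup>*" by blast
qed

section \<open>Positions over cyclic vertices\<close>

definition per :: "int \<Rightarrow> bool" where
  "per t \<longleftrightarrow> (\<exists>k\<ge>1. int n dvd (F ^^ k) t - t)"

lemma cyclic_vx_iff: "cyclic_vertex n p (vx n t) \<longleftrightarrow> per t"
proof -
  have "cyclic_vertex n p (vx n t) \<longleftrightarrow>
      (\<exists>b. (vx n t, b) \<in> res_arrows n p \<and> (b, vx n t) \<in> (res_arrows n p)\<^sup>*)"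
    using vx_in_verts[OF n_pos] by (auto simp: cyclic_vertex_def trancl_unfold_left)
  also have "\<dots> \<longleftrightarrow> (\<exists>k. vx n t = vx n ((F ^^ k) (F t)))"
    using vx_in_verts[OF n_pos] by (auto simp: res_arrow_iff res_map_vx res_reach_iff)
  also have "\<dots> \<longleftrightarrow> (\<exists>k. vx n ((F ^^ Suc k) t) = vx n t)"
    by (simp add: funpow_swap1) metis
  also have "\<dots> \<longleftrightarrow> (\<exists>k. int n dvd (F ^^ Suc k) t - t)"
    by (simp only: vx_eq_iff[OF n_pos])
  also have "\<dots> \<longleftrightarrow> per t"
    unfolding per_def by (metis Suc_le_D le_add1 plus_1_eq_Suc One_nat_def)
  finally show ?thesis .
qed

lemma dvd_diffE:
  fixes a b m :: int
  assumes "m dvd a - b"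
  obtains z where "a = b + m * z"
proof -
  from assms obtain z where "a - b = m * z" by (rule dvdE)
  then show thesis using that[of z] by simp
qed

lemma Fp_Fp: "(F ^^ i) ((F ^^ j) t) = (F ^^ (i + j)) t"
  by (simp add: funpow_add)

lemma per_iterate:
  assumes "int n dvd (F ^^ k) t - t"
  shows "int n dvd (F ^^ (k * j)) t - t"
proof (induction j)
  case (Suc j)
  from assms obtain z where z: "(F ^^ k) t = t + int n * z" by (rule dvd_diffE)
  have "(F ^^ (k * Suc j)) t = (F ^^ (k * j)) ((F ^^ k) t)"
    by (simp add: Fp_Fp add.commute)
  also have "\<dots> = (F ^^ (k * j)) t + int n * z" by (simp add: z Fp_add_mult)
  finally have "(F ^^ (k * Suc j)) t - t = ((F ^^ (k * j)) t - t) + int n * z" by simp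
  with Suc show ?case by (simp only: dvd_add_left_iff dvd_triv_left)
qed simp

text \<open>Going round \<open>m\<close> times takes \<open>k * m \<ge> m\<close> steps; stopping
  \<open>m\<close> steps early and translating back by the total displacement gives the
  preimage.\<close>

lemma per_preimage:
  assumes "per t"
  obtains s where "per s" "(F ^^ m) s = t"
proof -
  obtain k where k: "k \<ge> 1" "int n dvd (F ^^ k) t - t" using assms by (auto simp: per_def)
  obtain z where z: "(F ^^ (k * m)) t = t + int n * z"
    using dvd_diffE[OF per_iterate[OF k(2), of m]] .
  define s where "s = (F ^^ (k * m - m)) t + int n * (- z)"
  have km: "m + (k * m - m) = k * m" using k(1) by simp
  have "(F ^^ m) s = (F ^^ (k * m)) t + int n * (- z)"
    unfolding s_def Fp_add_mult Fp_Fp km ..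
  then have 1: "(F ^^ m) s = t" using z by simp
  have "(F ^^ k) s - s = (F ^^ (k * m - m)) ((F ^^ k) t) - (F ^^ (k * m - m)) t"
    unfolding s_def Fp_add_mult Fp_Fp by (simp add: add.commute)
  moreover from k(2) obtain w where "(F ^^ k) t = t + int n * w"
    by (rule dvd_diffE)
  ultimately have "int n dvd (F ^^ k) s - s" by (simp add: Fp_add_mult)
  with k(1) have "per s" by (auto simp: per_def)
  with 1 that show thesis by blast
qed

lemma per_Fp: "per t \<Longrightarrow> per ((F ^^ m) t)"
proof -
  assume "per t"
  then obtain k where k: "k \<ge> 1" "int n dvd (F ^^ k) t - t" by (auto simp: per_def)
  from k(2) obtain w where "(F ^^ k) t = t + int n * w" by (rule dvd_diffE)
  then have "(F ^^ k) ((F ^^ m) t) = (F ^^ m) t + int n * w"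
    by (metis Fp_Fp Fp_add_mult add.commute)
  then show ?thesis using k(1) by (auto simp: per_def)
qed

lemma per_add_mult: "per (t + int n * z) \<longleftrightarrow> per t"
  by (simp add: per_def Fp_add_mult)

text \<open>By pigeonhole every orbit becomes periodic. A maximum over the positions
  \<open>1, ..., n\<close> bounds all delays because \<open>F\<close> commutes with translation by
  \<open>n\<close>.\<close>

lemma ex_per: "\<exists>M. \<forall>t. \<forall>m\<ge>M. per ((F ^^ m) t)"
proof -
  have "\<exists>i. per ((F ^^ i) t)" for t
  proof -
    have "\<not> inj_on (\<lambda>i. vx n ((F ^^ i) t)) {0..n}"
    proof
      assume "inj_on (\<lambda>i. vx n ((F ^^ i) t)) {0..n}"
      then have "card {0..n} \<le> card (verts n)"
        by (rule card_inj_on_le) (use vx_in_verts[OF n_pos] in \<open>auto simp: verts_def\<close>)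
      then show False by (simp add: verts_def)
    qed
    then obtain i j where ij: "i < j" "vx n ((F ^^ i) t) = vx n ((F ^^ j) t)"
      unfolding inj_on_def by (metis linorder_neqE_nat)
    then have "int n dvd (F ^^ (j - i)) ((F ^^ i) t) - (F ^^ i) t"
      by (simp add: Fp_Fp) (metis vx_eq_iff[OF n_pos])
    then have "per ((F ^^ i) t)" using ij(1) unfolding per_def by (intro exI[of _ "j - i"]) auto
    then show ?thesis ..
  qed
  then obtain i where i: "\<And>t. per ((F ^^ i t) t)" by metis
  define M where "M = Max ((\<lambda>a. i (int a)) ` verts n)"
  have "per ((F ^^ m) t)" if "m \<ge> M" for m t
  proof -
    have v: "vx n t \<in> verts n" by (rule vx_in_verts[OF n_pos])
    then have "i (int (vx n t)) \<le> M" unfolding M_def by (intro Max_ge) (auto simp: verts_def)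
    then have "m - i (int (vx n t)) + i (int (vx n t)) = m" using that by simp
    then have "per ((F ^^ m) (int (vx n t)))" using per_Fp[OF i] Fp_Fp by metis
    moreover have "int n dvd t - int (vx n t)" using vx_of_nat[OF v] vx_eq_iff[OF n_pos] by metis
    then obtain z where "t = int (vx n t) + int n * z" by (rule dvd_diffE)
    ultimately show ?thesis by (metis Fp_add_mult per_add_mult)
  qed
  then show ?thesis by blast
qed

text \<open>For cyclic \<open>t\<close> this says that the cosyzygy of degree \<open>2 m + 1\<close> of the simple module at \<open>t\<close>
  vanishes.\<close>

definition cosyz_zero :: "nat \<Rightarrow> int \<Rightarrow> bool" where
  "cosyz_zero m t \<longleftrightarrow> (\<forall>k. (F ^^ Suc m) k > t \<longrightarrow> (F ^^ m) k \<ge> t)"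

text \<open>The hypothesis forbids cyclic positions strictly between \<open>t\<close> and
  \<open>F t\<close>. Take the last orbit point not above \<open>y\<close> and pull \<open>y\<close>
  back by as many steps: the result is cyclic and below \<open>F t\<close>, hence at most
  \<open>t\<close>, and monotonicity gives \<open>y \<le> (F ^^ k) t\<close>.\<close>

lemma cosyz_zero_orbit:
  assumes t: "per t" and c: "cosyz_zero m t" and y: "per y" "t \<le> y"
  shows "\<exists>k. y = (F ^^ k) t"
proof -
  define k where "k = (GREATEST k. (F ^^ k) t \<le> y)"
  have bd: "(F ^^ k) t \<le> y \<Longrightarrow> k \<le> nat (y - t)" for k
    using Fp_ge[of t k] by linarith
  have k1: "(F ^^ k) t \<le> y"
    unfolding k_def by (rule GreatestI_nat[of "\<lambda>k. (F ^^ k) t \<le> y" 0]) (use y(2) bd in auto)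
  have k2: "y < (F ^^ Suc k) t"
  proof (rule ccontr)
    assume "\<not> y < (F ^^ Suc k) t"
    then have "Suc k \<le> k" unfolding k_def
      by (intro Greatest_le_nat[of "\<lambda>k. (F ^^ k) t \<le> y" _ "nat (y - t)"]) (use bd in auto)
    then show False by simp
  qed
  obtain y' where y': "per y'" "(F ^^ k) y' = y" using per_preimage[OF y(1)] .
  obtain x where x: "per x" "(F ^^ Suc m) x = y'" using per_preimage[OF y'(1)] .
  have "y' < F t"
  proof (rule ccontr)
    assume "\<not> y' < F t"
    then have "(F ^^ k) (F t) \<le> (F ^^ k) y'" by (intro Fp_mono) simp
    with y'(2) k2 show False by (simp add: funpow_swap1)
  qed
  moreover have "y' > t \<Longrightarrow> F t \<le> y'"
    using c x(2) monoD[OF F_mono, of t "(F ^^ m) x"] by (auto simp: cosyz_zero_def)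
  ultimately have "y' \<le> t" by linarith
  from Fp_mono[OF this, of k] k1 y'(2) show ?thesis by (intro exI[of _ k]) simp
qed

section \<open>Weights of cycles as displacements along orbits\<close>

lemma F_telescope: "(\<Sum>k<c. int (p (vx n ((F ^^ k) t)))) = (F ^^ c) t - t"
  by (induction c) (auto simp: F_def)

text \<open>The chain \<open>t < F t < F (F t) < \<dots>\<close> meets every residue class of the cycle exactly once
  before it reaches \<open>t + int n * w\<close>, provided \<open>c\<close> is the least exponent for which this happens.\<close>

lemma cycle_weight_orbit:
  assumes c: "(F ^^ c) t = t + int n * w" "c \<ge> 1"
    and least: "\<And>j. 1 \<le> j \<Longrightarrow> j < c \<Longrightarrow> \<not> int n dvd (F ^^ j) t - t"
  shows "cycle_weight n p {b. (vx n t, b) \<in> (res_arrows n p)\<^sup>*} = of_int w"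
proof -
  have reach: "{b. (vx n t, b) \<in> (res_arrows n p)\<^sup>*} = (\<lambda>k. vx n ((F ^^ k) t)) ` {..<c}"
  proof safe
    fix b assume "(vx n t, b) \<in> (res_arrows n p)\<^sup>*"
    then obtain k where b: "b = vx n ((F ^^ k) t)" by (auto simp: res_reach_iff)
    have "int n dvd (F ^^ c) t - t" using c by simp
    then have "int n dvd (F ^^ (c * (k div c))) t - t" by (rule per_iterate)
    then obtain z where z: "(F ^^ (c * (k div c))) t = t + int n * z"
      by (rule dvd_diffE)
    have "(F ^^ k) t = (F ^^ (k mod c)) ((F ^^ (c * (k div c))) t)"
      by (simp add: Fp_Fp)
    then have "b = vx n ((F ^^ (k mod c)) t)" by (simp add: b z Fp_add_mult vx_add_mult)
    then show "b \<in> (\<lambda>k. vx n ((F ^^ k) t)) ` {..<c}" using c(2) by auto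
  qed (auto simp: res_reach_iff)
  have inj: "inj_on (\<lambda>k. vx n ((F ^^ k) t)) {..<c}"
  proof (rule inj_onI, rule ccontr)
    \<comment> \<open>If the orbit repeats a vertex at steps \<open>i < j < c\<close>, cutting out
      the loop gives a return to \<open>vx n t\<close> after \<open>c - j + i\<close> steps.\<close>
    have *: False if ij: "i < j" "j < c" "vx n ((F ^^ j) t) = vx n ((F ^^ i) t)" for i j
    proof -
      obtain z where z: "(F ^^ j) t = (F ^^ i) t + int n * z"
        using dvd_diffE ij(3) unfolding vx_eq_iff[OF n_pos] .
      have "(F ^^ (c - j + i)) t + int n * z = (F ^^ (c - j)) ((F ^^ i) t + int n * z)"
        by (simp add: Fp_add_mult Fp_Fp)
      also have "\<dots> = (F ^^ c) t" unfolding z[symmetric] Fp_Fp using ij(2) by simp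
      finally have "(F ^^ (c - j + i)) t - t = int n * (w - z)" using c(1)
        by (simp add: algebra_simps)
      then have "int n dvd (F ^^ (c - j + i)) t - t" by simp
      moreover have "1 \<le> c - j + i" "c - j + i < c" using ij by auto
      ultimately show False using least by blast
    qed
    fix i j assume "i \<in> {..<c}" "j \<in> {..<c}" "vx n ((F ^^ i) t) = vx n ((F ^^ j) t)" "i \<noteq> j"
    then show False using *[of i j] *[of j i] by (cases i j rule: linorder_cases) auto
  qed
  have "int (\<Sum>a\<in>{b. (vx n t, b) \<in> (res_arrows n p)\<^sup>*}. p a) = (F ^^ c) t - t"
    unfolding reach sum.reindex[OF inj] F_telescope[symmetric] by simp
  then have "int (\<Sum>a\<in>{b. (vx n t, b) \<in> (res_arrows n p)\<^sup>*}. p a) = int n * w" using c by simp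
  then have "rat_of_nat (\<Sum>a\<in>{b. (vx n t, b) \<in> (res_arrows n p)\<^sup>*}. p a) = of_nat n * of_int w"
    by (metis of_int_mult of_int_of_nat_eq)
  then show ?thesis using n_pos by (simp add: cycle_weight_def)
qed

lemma per_least_period:
  assumes "per t"
  obtains c w where "(F ^^ c) t = t + int n * w" "c \<ge> 1"
    "\<And>j. 1 \<le> j \<Longrightarrow> j < c \<Longrightarrow> \<not> int n dvd (F ^^ j) t - t"
proof -
  define c where "c = (LEAST k. k \<ge> 1 \<and> int n dvd (F ^^ k) t - t)"
  have c: "c \<ge> 1 \<and> int n dvd (F ^^ c) t - t" unfolding c_def
    by (rule LeastI_ex) (use assms in \<open>auto simp: per_def\<close>)
  then obtain w where "(F ^^ c) t = t + int n * w" using dvd_diffE by blast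
  moreover have "\<not> int n dvd (F ^^ j) t - t" if "1 \<le> j" "j < c" for j
    using not_less_Least[of j "\<lambda>k. k \<ge> 1 \<and> int n dvd (F ^^ k) t - t"] that c_def by blast
  ultimately show thesis using c that by blast
qed

text \<open>From \<open>y\<close> another \<open>c * k - k\<close> steps complete \<open>k\<close>
  rounds of length \<open>c\<close>, which leads back to the vertex of \<open>t\<close>.\<close>

lemma reach_cong:
  assumes "y = (F ^^ k) t" "per t"
  shows "{b. (vx n y, b) \<in> (res_arrows n p)\<^sup>*} = {b. (vx n t, b) \<in> (res_arrows n p)\<^sup>*}"
proof -
  obtain c where c: "c \<ge> 1" "int n dvd (F ^^ c) t - t" using assms(2) by (auto simp: per_def)
  have "vx n ((F ^^ (c * k - k)) y) = vx n t"
    using per_iterate[OF c(2), of k] c(1)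
    unfolding assms(1) Fp_Fp vx_eq_iff[OF n_pos] by simp
  then have "(vx n y, vx n t) \<in> (res_arrows n p)\<^sup>*" unfolding res_reach_iff by metis
  moreover have "(vx n t, vx n y) \<in> (res_arrows n p)\<^sup>*" unfolding res_reach_iff assms(1) by blast
  ultimately show ?thesis by (auto intro: rtrancl_trans)
qed

text \<open>The definite description in \<open>res_weight\<close> needs a unique value;
  \<open>orb\<close> provides it by making the cycle through \<open>t\<close> the only one.\<close>

lemma res_weight_eqI:
  assumes t: "per t" and orb: "\<And>y. per y \<Longrightarrow> \<exists>k. vx n y = vx n ((F ^^ k) t)"
  shows "res_weight n p = cycle_weight n p {b. (vx n t, b) \<in> (res_arrows n p)\<^sup>*}"
proof -
  have "res_cycle n p {b. (vx n t, b) \<in> (res_arrows n p)\<^sup>*}"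
    unfolding res_cycle_def using t cyclic_vx_iff by blast
  moreover have "I = {b. (vx n t, b) \<in> (res_arrows n p)\<^sup>*}" if I: "res_cycle n p I" for I
  proof -
    obtain a where a: "cyclic_vertex n p a" "I = {b. (a, b) \<in> (res_arrows n p)\<^sup>*}"
      using I unfolding res_cycle_def by blast
    then have va: "vx n (int a) = a" using vx_of_nat by (auto simp: cyclic_vertex_def)
    then have "per (int a)" using a(1) cyclic_vx_iff[of "int a"] by simp
    then obtain k where "a = vx n ((F ^^ k) t)" using orb va by metis
    then show ?thesis using reach_cong[OF refl t] a(2) by metis
  qed
  ultimately have "res_cycle n p I \<longleftrightarrow> I = {b. (vx n t, b) \<in> (res_arrows n p)\<^sup>*}" for I
    by blast
  then show ?thesis unfolding res_weight_def by simp
qed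

section \<open>Connectedness and weight one in terms of cyclic positions\<close>

lemma connected_weight_one:
  assumes t: "per t" and c: "cosyz_zero m t"
  shows "res_connected n p \<and> res_weight n p = 1"
proof
  have orb: "\<exists>k. vx n y = vx n ((F ^^ k) t)" if "per y" for y
  proof -
    \<comment> \<open>This translation keeps the vertex of \<open>y\<close> and lifts it above
      \<open>t\<close>, where \<open>cosyz_zero_orbit\<close> applies.\<close>
    have "t \<le> y + int n * \<bar>t - y\<bar>"
    proof -
      have "\<bar>t - y\<bar> * 1 \<le> \<bar>t - y\<bar> * int n" using n_pos by (intro mult_left_mono) auto
      then show ?thesis by (simp add: mult.commute)
    qed
    moreover have "per (y + int n * \<bar>t - y\<bar>)" using that by (simp add: per_add_mult)
    ultimately show ?thesis using cosyz_zero_orbit[OF t c] vx_add_mult by metis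
  qed
  \<comment> \<open>The origin of weight one: \<open>t + n\<close> is cyclic as well, so the orbit
    of \<open>t\<close> cannot jump over it.\<close>
  have "\<exists>k. t + int n * 1 = (F ^^ k) t"
    using t by (intro cosyz_zero_orbit[OF t c]) (simp only: per_add_mult, simp)
  then obtain c where c: "(F ^^ c) t = t + int n * 1" by metis
  have c1: "c \<ge> 1" using c n_pos by (cases c) auto
  have "\<not> int n dvd (F ^^ j) t - t" if "1 \<le> j" "j < c" for j
  proof
    assume "int n dvd (F ^^ j) t - t"
    moreover have "0 < (F ^^ j) t - t" using Fp_ge[of t j] that by simp
    moreover have "(F ^^ j) t - t < int n" using Fp_less[OF that(2), of t] c by simp
    ultimately show False using zdvd_imp_le by force
  qed
  from cycle_weight_orbit[OF c c1 this] show "res_weight n p = 1"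
    using res_weight_eqI[OF t orb] by simp
  obtain M where M: "\<forall>t. \<forall>m\<ge>M. per ((F ^^ m) t)" using ex_per by blast
  let ?E = "res_arrows n p \<union> (res_arrows n p)\<inverse>"
  \<comment> \<open>After \<open>M\<close> steps every vertex is on the only cycle; the cycle is
    then followed backwards to \<open>t\<close>.\<close>
  have conn: "(a, vx n t) \<in> ?E\<^sup>*" if "a \<in> verts n" for a
  proof -
    obtain k where "vx n ((F ^^ M) (int a)) = vx n ((F ^^ k) t)" using orb M by blast
    then have "(a, vx n ((F ^^ k) t)) \<in> (res_arrows n p)\<^sup>*"
      using res_reach_iff[of "int a"] vx_of_nat[OF that] by metis
    moreover have "(vx n ((F ^^ k) t), vx n t) \<in> ((res_arrows n p)\<inverse>)\<^sup>*"
      unfolding rtrancl_converse using res_reach_iff by blast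
    ultimately have "(a, vx n ((F ^^ k) t)) \<in> ?E\<^sup>*" "(vx n ((F ^^ k) t), vx n t) \<in> ?E\<^sup>*"
      by (simp_all add: in_rtrancl_UnI)
    then show ?thesis by (rule rtrancl_trans)
  qed
  have "sym (?E\<^sup>*)" by (rule sym_rtrancl) (auto simp: sym_def)
  then have "(vx n t, a) \<in> ?E\<^sup>*" if "a \<in> verts n" for a
    using conn[OF that] by (rule symD)
  with conn show "res_connected n p" unfolding res_connected_def
    by (blast intro: rtrancl_trans)
qed

text \<open>With a single cycle of weight one the cyclic positions are one orbit of
  \<open>F\<close>, extended in both directions, so no cyclic \<open>y\<close> satisfies
  \<open>y < t < F y\<close>. Taking \<open>m\<close> so large that \<open>F ^^ m\<close> has only
  cyclic values turns this into \<open>cosyz_zero\<close>.\<close>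

lemma ex_cosyz_zero:
  assumes conn: "res_connected n p" and w: "res_weight n p = 1"
  shows "\<exists>t m. per t \<and> cosyz_zero m t"
proof -
  obtain M where M: "\<And>t. per ((F ^^ M) t)" using ex_per by blast
  define t where "t = (F ^^ M) 0"
  have t: "per t" using M by (simp add: t_def)
  \<comment> \<open>Each vertex has one outgoing arrow, so an undirected walk yields a common
    descendant of its ends.\<close>
  have common: "\<exists>r s. (res_map n p ^^ r) a = (res_map n p ^^ s) b"
    if "(a, b) \<in> (res_arrows n p \<union> (res_arrows n p)\<inverse>)\<^sup>*" for a b
    using that
  proof induction
    case base
    show ?case by blast
  next
    case (step y z)
    then obtain r s where rs: "(res_map n p ^^ r) a = (res_map n p ^^ s) y" by blast
    from step(2) consider "z = res_map n p y" | "y = res_map n p z" by (auto simp: res_arrow_iff)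
    then show ?case
    proof cases
      case 1
      have "(res_map n p ^^ Suc r) a = (res_map n p ^^ s) z"
        using rs 1 by (simp add: funpow_swap1)
      then show ?thesis by blast
    next
      case 2
      have "(res_map n p ^^ r) a = (res_map n p ^^ Suc s) z"
        using rs 2 by (simp add: funpow_swap1)
      then show ?thesis by blast
    qed
  qed
  have orb: "\<exists>k. vx n y = vx n ((F ^^ k) t)" if y: "per y" for y
  proof -
    obtain r s where "(res_map n p ^^ r) (vx n y) = (res_map n p ^^ s) (vx n t)"
      using common conn vx_in_verts[OF n_pos] unfolding res_connected_def by meson
    then have rs: "vx n ((F ^^ r) y) = vx n ((F ^^ s) t)" by (simp add: res_map_pow_vx)
    obtain k where k: "k \<ge> 1" "int n dvd (F ^^ k) y - y" using y by (auto simp: per_def)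
    have "vx n y = vx n ((F ^^ (k * r)) y)"
      using per_iterate[OF k(2), of r] by (metis vx_eq_iff[OF n_pos])
    also have "\<dots> = vx n ((F ^^ (k * r - r)) ((F ^^ r) y))"
      using k(1) by (simp add: Fp_Fp)
    also have "\<dots> = vx n ((F ^^ (k * r - r)) ((F ^^ s) t))"
      unfolding res_map_pow_vx[symmetric] using rs by (simp only: res_map_pow_vx)
    also have "\<dots> = vx n ((F ^^ (k * r - r + s)) t)" by (simp add: funpow_add)
    finally show ?thesis by blast
  qed
  obtain c w' where c: "(F ^^ c) t = t + int n * w'" "c \<ge> 1"
    "\<And>j. 1 \<le> j \<Longrightarrow> j < c \<Longrightarrow> \<not> int n dvd (F ^^ j) t - t"
    using per_least_period[OF t] by metis
  have "w' = 1" using cycle_weight_orbit[OF c] res_weight_eqI[OF t orb] w by simp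
  with c have ct: "(F ^^ c) t = t + int n" by simp
  have ctz: "(F ^^ (c * z)) t = t + int n * int z" for z
  proof (induction z)
    case (Suc z)
    have "(F ^^ (c * Suc z)) t = (F ^^ c) ((F ^^ (c * z)) t)" by (simp add: funpow_add)
    also have "\<dots> = t + int n * int (Suc z)"
      unfolding Suc Fp_add_mult ct by (simp add: algebra_simps)
    finally show ?case .
  qed simp
  have "cosyz_zero M t" unfolding cosyz_zero_def
  proof (intro allI impI, rule ccontr)
    fix k assume k: "t < (F ^^ Suc M) k" "\<not> t \<le> (F ^^ M) k"
    define y where "y = (F ^^ M) k"
    have y: "per y" "y < t" "t < F y" using k M by (auto simp: y_def)
    obtain s where "vx n y = vx n ((F ^^ s) t)" using orb[OF y(1)] by blast
    then obtain z where z: "y = (F ^^ s) t + int n * z"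
      unfolding vx_eq_iff[OF n_pos] by (rule dvd_diffE)
    \<comment> \<open>Exponents of \<open>F\<close> are natural numbers: raising \<open>y\<close> by
      \<open>n * u\<close> makes the number of turns \<open>z + u\<close> nonnegative, and the
      translate of \<open>y\<close> becomes a forward iterate of \<open>t\<close>.\<close>
    define u where "u = nat \<bar>z\<bar>"
    have 1: "y + int n * int u = (F ^^ s) t + int n * (z + int u)"
      by (simp add: z algebra_simps)
    define q where "q = nat (z + int u)"
    have q: "z + int u = int q" by (auto simp: q_def u_def)
    have 2: "y + int n * int u = (F ^^ (s + c * q)) t"
      unfolding 1 q Fp_Fp[symmetric] ctz Fp_add_mult by simp
    have "(F ^^ (s + c * q)) t < (F ^^ (c * u)) t" unfolding 2[symmetric] ctz using y(2) by simp
    then have "Suc (s + c * q) \<le> c * u" unfolding Fp_less_iff by simp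
    then have "(F ^^ Suc (s + c * q)) t \<le> (F ^^ (c * u)) t" by (rule Fp_le)
    moreover have "(F ^^ Suc (s + c * q)) t = F y + int n * int u"
      using 2 F_add_mult[of y "int u"] by simp
    ultimately show False using y(3) ctz by simp
  qed
  with t show ?thesis by blast
qed

end

section \<open>Coefficients in the quotient algebra\<close>

lemma path_algebra_add:
  assumes "f \<in> path_algebra n" "g \<in> path_algebra n"
  shows "f + g \<in> path_algebra n"
proof -
  have "{q. (f + g) q \<noteq> 0} \<subseteq> {q. f q \<noteq> 0} \<union> {q. g q \<noteq> 0}" by auto
  moreover have "finite ({q. f q \<noteq> 0} \<union> {q. g q \<noteq> 0})"
    "{q. f q \<noteq> 0} \<union> {q. g q \<noteq> 0} \<subseteq> quiver_paths n"
    using assms by (simp_all add: path_algebra_def)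
  ultimately show ?thesis unfolding path_algebra_def mem_Collect_eq
    by (meson finite_subset order_trans)
qed

lemma path_algebra_scale: "f \<in> path_algebra n \<Longrightarrow> path_scale c f \<in> path_algebra n"
  unfolding path_algebra_def path_scale_def
  by (auto intro: finite_subset[of _ "{p. f p \<noteq> 0}"])

lemma path_algebra_minus: "f \<in> path_algebra n \<Longrightarrow> g \<in> path_algebra n \<Longrightarrow> f - g \<in> path_algebra n"
proof -
  have "f - g = f + path_scale (- 1) g" by (simp add: fun_eq_iff path_scale_def)
  then show "f \<in> path_algebra n \<Longrightarrow> g \<in> path_algebra n \<Longrightarrow> f - g \<in> path_algebra n"
    by (simp only: path_algebra_add path_algebra_scale)
qed

lemma path_algebra_zero: "0 \<in> path_algebra n"
  by (simp add: path_algebra_def)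

lemma path_algebra_path_vec: "a \<in> verts n \<Longrightarrow> path_vec (a, l) \<in> path_algebra n"
  by (auto simp: path_algebra_def path_vec_def quiver_paths_def)

lemma path_mult_nonzero:
  assumes "path_mult n f g (a, l) \<noteq> 0"
  obtains i where "i \<le> l" "f (a, i) \<noteq> 0" "g ((rot n ^^ i) a, l - i) \<noteq> 0"
proof -
  have "(\<Sum>i\<le>l. f (a, i) * g ((rot n ^^ i) a, l - i)) \<noteq> 0"
    using assms by (simp add: path_mult_def)
  then obtain i where "i \<in> {..l}" "f (a, i) * g ((rot n ^^ i) a, l - i) \<noteq> 0"
    by (rule sum.not_neutral_contains_not_neutral)
  then show thesis using that by auto
qed

lemma path_algebra_mult:
  assumes f: "f \<in> path_algebra n" and g: "g \<in> path_algebra n"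
  shows "path_mult n f g \<in> path_algebra n"
proof -
  let ?h = "\<lambda>((a, i), (b, m)). (a :: nat, i + m :: nat)"
  have "{q. path_mult n f g q \<noteq> 0} \<subseteq> ?h ` ({q. f q \<noteq> 0} \<times> {q. g q \<noteq> 0})"
  proof safe
    fix a l assume "path_mult n f g (a, l) \<noteq> 0"
    then obtain i where "i \<le> l" "f (a, i) \<noteq> 0" "g ((rot n ^^ i) a, l - i) \<noteq> 0"
      by (rule path_mult_nonzero)
    then show "(a, l) \<in> ?h ` ({q. f q \<noteq> 0} \<times> {q. g q \<noteq> 0})"
      by (intro image_eqI[of _ _ "((a, i), ((rot n ^^ i) a, l - i))"]) auto
  qed
  moreover have "finite (?h ` ({q. f q \<noteq> 0} \<times> {q. g q \<noteq> 0}))"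
    using f g by (auto simp: path_algebra_def)
  moreover have "a \<in> verts n" if "path_mult n f g (a, l) \<noteq> 0" for a l
    using that f by (elim path_mult_nonzero) (auto simp: path_algebra_def quiver_paths_def)
  ultimately show ?thesis
    by (auto simp: path_algebra_def quiver_paths_def intro: finite_subset)
qed

lemma path_one_apply:
  "path_one n (a, l) = (if a \<in> verts n \<and> l = 0 then 1 else 0 :: 'k::field)"
proof -
  have "sum f A q = (\<Sum>b\<in>A. f b q)" for f :: "nat \<Rightarrow> nat \<times> nat \<Rightarrow> 'k" and A q
    by (induction A rule: infinite_finite_induct) auto
  then have "path_one n (a, l) = (\<Sum>b\<in>verts n. path_vec (b, 0) (a, l) :: 'k)"
    unfolding path_one_def by blast
  also have "\<dots> = (\<Sum>b\<in>verts n. if b = a then (if l = 0 then 1 else 0) else 0)"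
    by (rule sum.cong) (auto simp: path_vec_def)
  also have "\<dots> = (if a \<in> verts n \<and> l = 0 then 1 else 0)"
    by (subst sum.delta) (auto simp: verts_def)
  finally show ?thesis .
qed

locale nakayama =
  fixes n :: nat
    and R :: "(nat \<times> nat) set"
    and scale :: "'k::field \<Rightarrow> 'a::ring_1 \<Rightarrow> 'a"
    and \<pi> :: "(nat \<times> nat \<Rightarrow> 'k) \<Rightarrow> 'a"
  assumes nakayama: "nakayama_algebra n R scale \<pi>"
begin

sublocale alg: vector_space scale
  using nakayama by (simp add: nakayama_algebra_def fd_algebra_def)

lemma n_ge1: "n \<ge> 1"
  using nakayama by (simp add: nakayama_algebra_def)

lemma scale_mult: "scale c x * y = scale c (x * y)" "x * scale c y = scale c (x * y)"
  using nakayama by (simp_all add: nakayama_algebra_def fd_algebra_def)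

lemma pi_add: "x \<in> path_algebra n \<Longrightarrow> y \<in> path_algebra n \<Longrightarrow> \<pi> (x + y) = \<pi> x + \<pi> y"
  and pi_mult: "x \<in> path_algebra n \<Longrightarrow> y \<in> path_algebra n \<Longrightarrow> \<pi> (path_mult n x y) = \<pi> x * \<pi> y"
  and pi_scale: "x \<in> path_algebra n \<Longrightarrow> \<pi> (path_scale c x) = scale c (\<pi> x)"
  and pi_one: "\<pi> (path_one n) = 1"
  using nakayama by (simp_all add: nakayama_algebra_def path_algebra_hom_def)

lemma pi_zero: "\<pi> 0 = 0"
  using pi_add[OF path_algebra_zero path_algebra_zero] by simp

lemma pi_minus: "x \<in> path_algebra n \<Longrightarrow> y \<in> path_algebra n \<Longrightarrow> \<pi> (x - y) = \<pi> x - \<pi> y"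
  using pi_add[of "x - y" y] path_algebra_minus[of x n y] by (simp add: algebra_simps)

lemma pi_surj: obtains y where "y \<in> path_algebra n" "\<pi> y = x"
  using nakayama unfolding nakayama_algebra_def by (metis UNIV_I imageE)

text \<open>A path with a subpath in \<open>R\<close>: \<open>i\<close> steps, a relation of length
  \<open>m\<close>, then \<open>k\<close> steps. As the relations are paths, the bad paths of the
  quiver span the ideal.\<close>

definition bad :: "nat \<times> nat \<Rightarrow> bool" where
  "bad q \<longleftrightarrow> (\<exists>i m k. snd q = i + m + k \<and> ((rot n ^^ i) (fst q), m) \<in> R)"

lemma bad_right: "bad (a, l) \<Longrightarrow> bad (a, l + m)"
  unfolding bad_def fst_conv snd_conv by (metis add.assoc)

lemma bad_left: "bad ((rot n ^^ m) a, l) \<Longrightarrow> bad (a, m + l)"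
proof -
  assume "bad ((rot n ^^ m) a, l)"
  then obtain i j k where "l = i + j + k" "((rot n ^^ i) ((rot n ^^ m) a), j) \<in> R"
    unfolding bad_def by auto
  then have "m + l = (m + i) + j + k" "((rot n ^^ (m + i)) a, j) \<in> R"
    by (simp_all add: funpow_add add.commute[of m i])
  then show ?thesis unfolding bad_def fst_conv snd_conv by blast
qed

lemma not_bad_0: "\<not> bad (a, 0)"
proof
  assume "bad (a, 0)"
  then have "(a, 0) \<in> R" by (simp add: bad_def)
  then show False using nakayama by (auto simp: nakayama_algebra_def)
qed

text \<open>This ideal contains the relations and hence the kernel of \<open>\<pi>\<close>, so
  coefficients at paths that are not bad are well defined on the quotient.\<close>

lemma ideal_bad:
  "two_sided_ideal n {f \<in> path_algebra n. \<forall>q. (f q :: 'k) \<noteq> 0 \<longrightarrow> bad q}" (is "two_sided_ideal n ?J")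
  unfolding two_sided_ideal_def
proof (intro conjI ballI)
  show "?J \<subseteq> path_algebra n" by auto
  show "0 \<in> ?J" by (simp add: path_algebra_zero)
next
  fix x y assume xy: "x \<in> ?J" "y \<in> ?J"
  show "x - y \<in> ?J"
  proof (intro CollectI conjI allI impI)
    fix q assume "(x - y) q \<noteq> 0"
    then have "x q \<noteq> 0 \<or> y q \<noteq> 0" by auto
    then show "bad q" using xy by blast
  qed (use xy path_algebra_minus in auto)
next
  fix x and r :: "nat \<times> nat \<Rightarrow> 'k" assume x: "x \<in> ?J" and r: "r \<in> path_algebra n"
  have "bad (a, l)" if nz: "path_mult n r x (a, l) \<noteq> 0" for a l
  proof -
    obtain i where "i \<le> l" "x ((rot n ^^ i) a, l - i) \<noteq> 0"
      using nz by (rule path_mult_nonzero)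
    then show ?thesis using x bad_left[of i a "l - i"] by simp
  qed
  then show "path_mult n r x \<in> ?J" using x r path_algebra_mult by auto
  have "bad (a, l)" if nz: "path_mult n x r (a, l) \<noteq> 0" for a l
  proof -
    obtain i where "i \<le> l" "x (a, i) \<noteq> 0" using nz by (rule path_mult_nonzero)
    then show ?thesis using x bad_right[of a i "l - i"] by simp
  qed
  then show "path_mult n x r \<in> ?J" using x r path_algebra_mult by auto
qed

lemma kernel_bad:
  assumes "y \<in> path_algebra n" "\<pi> y = 0" "y q \<noteq> 0"
  shows "bad q"
proof -
  have "path_vec ` R \<subseteq> {f \<in> path_algebra n. \<forall>q. (f q :: 'k) \<noteq> 0 \<longrightarrow> bad q}"
  proof safe
    fix a l assume al: "(a, l) \<in> R"
    then show "path_vec (a, l) \<in> path_algebra n"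
      using nakayama by (intro path_algebra_path_vec) (auto simp: nakayama_algebra_def quiver_paths_def)
    fix b m assume "path_vec (a, l) (b, m) \<noteq> (0 :: 'k)"
    then have "(b, m) = (a, l)" by (auto simp: path_vec_def split: if_splits)
    then have "snd (b, m) = 0 + l + 0 \<and> ((rot n ^^ 0) (fst (b, m)), l) \<in> R" using al by simp
    then show "bad (b, m)" unfolding bad_def by blast
  qed
  moreover have "y \<in> ideal_generated n (path_vec ` R)"
    using assms nakayama by (auto simp: nakayama_algebra_def)
  ultimately show ?thesis using ideal_bad assms(3) unfolding ideal_generated_def by blast
qed

lemma rot_pow_verts: "a \<in> verts n \<Longrightarrow> (rot n ^^ i) a \<in> verts n"
  by (induction i) (auto simp: rot_def verts_def)

lemma pi_bad:
  assumes a: "a \<in> verts n" and b: "bad (a, l)"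
  shows "\<pi> (path_vec (a, l)) = 0"
proof -
  obtain i m k where l: "l = i + m + k" and r: "((rot n ^^ i) a, m) \<in> R"
    using b by (auto simp: bad_def)
  let ?b = "(rot n ^^ i) a"
  have "path_vec (?b, m) \<in> ideal_generated n (path_vec ` R :: (nat \<times> nat \<Rightarrow> 'k) set)"
    using r by (auto simp: ideal_generated_def)
  then have 0: "\<pi> (path_vec (?b, m)) = 0" using nakayama by (auto simp: nakayama_algebra_def)
  have v: "path_vec (a, i) \<in> path_algebra n" "path_vec (?b, m) \<in> path_algebra n"
    "path_vec ((rot n ^^ m) ?b, k) \<in> path_algebra n"
    using a by (auto intro!: path_algebra_path_vec rot_pow_verts)
  have eq: "path_vec (a, l) =
      path_mult n (path_vec (a, i)) (path_mult n (path_vec (?b, m)) (path_vec ((rot n ^^ m) ?b, k)))"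
    by (simp add: path_mult_path_vec l add.assoc)
  have "\<pi> (path_vec (a, l)) = \<pi> (path_vec (a, i)) *
      \<pi> (path_mult n (path_vec (?b, m)) (path_vec ((rot n ^^ m) ?b, k)))"
    unfolding eq by (intro pi_mult path_algebra_mult v)
  also have "\<pi> (path_mult n (path_vec (?b, m)) (path_vec ((rot n ^^ m) ?b, k))) = 0"
    unfolding pi_mult[OF v(2,3)] 0 by simp
  finally show ?thesis by simp
qed

text \<open>Integer starting positions let a composable path simply continue at
  \<open>t + l\<close>, and \<open>F\<close> then tells where \<open>pth t l\<close>
  vanishes.\<close>

definition pth :: "int \<Rightarrow> nat \<Rightarrow> 'a" where
  "pth t l = \<pi> (path_vec (vx n t, l))"

lemma pth_vx: "a \<in> verts n \<Longrightarrow> \<pi> (path_vec (a, l)) = pth (int a) l"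
  by (simp add: pth_def vx_of_nat)

lemma idem_pth: "idem \<pi> (vx n t) = pth t 0"
  by (simp add: idem_def pth_def)

lemma pth_cong: "vx n s = vx n t \<Longrightarrow> pth s l = pth t l"
  by (simp add: pth_def)

lemma pth_mult:
  "pth t l * pth s m = (if vx n (t + int l) = vx n s then pth t (l + m) else 0)"
proof -
  have "pth t l * pth s m = \<pi> (path_mult n (path_vec (vx n t, l)) (path_vec (vx n s, m)))"
    unfolding pth_def by (intro pi_mult[symmetric] path_algebra_path_vec vx_in_verts n_ge1)
  then show ?thesis
    by (simp add: path_mult_path_vec rot_pow_vx[OF n_ge1] pi_zero pth_def del: of_nat_add)
qed

lemma alg_induct [case_names add scale path]:
  assumes add: "\<And>x y. P x \<Longrightarrow> P y \<Longrightarrow> P (x + y)"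
    and sc: "\<And>c x. P x \<Longrightarrow> P (scale c x)"
    and pth: "\<And>t l. P (pth t l)"
  shows "P x"
proof -
  have P0: "P 0" using sc[of "pth 0 0" 0] pth by simp
  have *: "finite S \<Longrightarrow> y \<in> path_algebra n \<Longrightarrow> {q. y q \<noteq> 0} \<subseteq> S \<Longrightarrow> P (\<pi> y)" for S y
  proof (induction S arbitrary: y rule: finite_induct)
    case empty
    then have "y = 0" by (auto simp: fun_eq_iff)
    then have "\<pi> y = 0" using pi_zero by (simp only:)
    then show ?case using P0 by (simp only:)
  next
    case (insert q S)
    define y' where "y' = y(q := 0)"
    have y': "y' \<in> path_algebra n" "{q. y' q \<noteq> 0} \<subseteq> S"
      using insert.prems by (auto simp: path_algebra_def y'_def intro: finite_subset[of _ "{q. y q \<noteq> 0}"])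
    show ?case
    proof (cases "y q = 0")
      case True
      then have "y' = y" by (auto simp: y'_def)
      then show ?thesis using insert.IH y' by simp
    next
      case False
      obtain a l where q: "q = (a, l)" by (cases q)
      have a: "a \<in> verts n" using insert.prems(1) False q by (auto simp: path_algebra_def quiver_paths_def)
      have "y = y' + path_scale (y q) (path_vec q)"
        by (auto simp: y'_def fun_eq_iff path_scale_def path_vec_def)
      then have "\<pi> y = \<pi> y' + scale (y q) (pth (int a) l)"
        using y'(1) a q by (metis pi_add pi_scale path_algebra_scale path_algebra_path_vec pth_vx)
      then show ?thesis using add sc pth insert.IH[OF y'] by simp
    qed
  qed
  obtain y where y: "y \<in> path_algebra n" "\<pi> y = x" by (rule pi_surj)
  then have "finite {q. y q \<noteq> 0}" by (simp add: path_algebra_def)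
  from *[OF this y(1) subset_refl] y(2) show ?thesis by simp
qed

text \<open>A representative of an element of the quotient algebra; its coefficients at the paths outside
  the ideal do not depend on the choice.\<close>

definition coef :: "'a \<Rightarrow> nat \<times> nat \<Rightarrow> 'k" where
  "coef x = (SOME y. y \<in> path_algebra n \<and> \<pi> y = x)"

lemma coef_in: "coef x \<in> path_algebra n" and pi_coef: "\<pi> (coef x) = x"
proof -
  obtain y where "y \<in> path_algebra n \<and> \<pi> y = x" using pi_surj by metis
  then have "coef x \<in> path_algebra n \<and> \<pi> (coef x) = x"
    unfolding coef_def by (rule someI[where P = "\<lambda>y. y \<in> path_algebra n \<and> \<pi> y = x"])
  then show "coef x \<in> path_algebra n" "\<pi> (coef x) = x" by auto
qed

lemma coef_pi:
  assumes "y \<in> path_algebra n" "\<not> bad q"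
  shows "coef (\<pi> y) q = y q"
proof (rule ccontr)
  assume "coef (\<pi> y) q \<noteq> y q"
  then have "(coef (\<pi> y) - y) q \<noteq> 0" by simp
  then show False
    using kernel_bad[of "coef (\<pi> y) - y" q] assms
    by (simp add: path_algebra_minus coef_in pi_minus pi_coef)
qed

lemma coef_eqI: "y \<in> path_algebra n \<Longrightarrow> \<pi> y = x \<Longrightarrow> \<not> bad q \<Longrightarrow> coef x q = y q"
  using coef_pi by blast

lemma coef_add:
  assumes "\<not> bad q"
  shows "coef (x + y) q = coef x q + coef y q"
proof -
  have "coef (x + y) q = (coef x + coef y) q"
    by (rule coef_eqI) (simp_all only: path_algebra_add coef_in pi_add pi_coef assms not_False_eq_True)
  then show ?thesis by simp
qed

lemma coef_scale:
  assumes "\<not> bad q"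
  shows "coef (scale c x) q = c * coef x q"
proof -
  have "coef (scale c x) q = path_scale c (coef x) q"
    by (rule coef_eqI) (simp_all only: path_algebra_scale coef_in pi_scale pi_coef assms not_False_eq_True)
  then show ?thesis by (simp add: path_scale_def)
qed

lemma coef_mult:
  assumes "\<not> bad (a, l)"
  shows "coef (x * y) (a, l) = (\<Sum>i\<le>l. coef x (a, i) * coef y ((rot n ^^ i) a, l - i))"
proof -
  have "coef (x * y) (a, l) = path_mult n (coef x) (coef y) (a, l)"
    by (rule coef_eqI) (simp_all only: path_algebra_mult coef_in pi_mult pi_coef assms not_False_eq_True)
  then show ?thesis by (simp add: path_mult_def)
qed

lemma path_one_in: "(path_one n :: nat \<times> nat \<Rightarrow> 'k) \<in> path_algebra n"
proof -
  have sub: "{q. path_one n q \<noteq> (0 :: 'k)} \<subseteq> verts n \<times> {0}"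
    by (auto simp: path_one_apply split: if_splits)
  moreover have "finite (verts n \<times> {0 :: nat})" by (simp add: verts_def)
  ultimately have "finite {q. path_one n q \<noteq> (0 :: 'k)}" by (rule finite_subset)
  with sub show ?thesis by (auto simp: path_algebra_def quiver_paths_def)
qed

lemma coef_one: "a \<in> verts n \<Longrightarrow> \<not> bad (a, l) \<Longrightarrow> coef 1 (a, l) = (if l = 0 then 1 else 0)"
  using coef_pi[OF path_one_in, of "(a, l)"] by (simp add: pi_one path_one_apply)

lemma coef_pth: "\<not> bad q \<Longrightarrow> coef (pth t l) q = (if q = (vx n t, l) then 1 else 0)"
  unfolding pth_def coef_pi[OF path_algebra_path_vec[OF vx_in_verts[OF n_ge1]]]
  by (simp add: path_vec_def)

text \<open>The nonzero paths starting at \<open>a\<close> form a basis of \<open>e_a A\<close>,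
  with \<open>coef\<close> supplying the functionals that show independence. Their lengths are
  closed under shortening, so they are \<open>0, ..., p_a - 1\<close>.\<close>

lemma bad_iff_dim:
  assumes a: "a \<in> verts n"
  shows "\<not> bad (a, l) \<longleftrightarrow> l < dim_proj scale \<pi> a"
proof -
  define G where "G = {l. \<not> bad (a, l)}"
  define b where "b l = \<pi> (path_vec (a, l))" for l
  have b_pth: "b l = pth (int a) l" for l using a by (simp add: b_def pth_vx)
  have coef_b: "coef (b m) (a, l) = (if l = m then 1 else 0)" if "l \<in> G" for l m
    using that a by (auto simp: G_def b_pth coef_pth vx_of_nat)
  have inj: "inj_on b G"
    by (rule inj_onI) (metis coef_b zero_neq_one)
  have sub: "alg.subspace {x. coef x (a, l) = 0}" if "l \<in> G" for l
    using that unfolding alg.subspace_def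
    by (auto simp: G_def coef_add coef_scale) (metis alg.scale_zero_left coef_scale mult_zero_left)
  have indep: "alg.independent (b ` G)"
  proof
    assume "alg.dependent (b ` G)"
    then obtain l where l: "l \<in> G" "b l \<in> alg.span (b ` G - {b l})"
      unfolding alg.dependent_def by blast
    have "alg.span (b ` G - {b l}) \<subseteq> {x. coef x (a, l) = 0}"
      using coef_b[OF l(1)] by (intro alg.span_minimal sub l) auto
    then have "coef (b l) (a, l) = 0" using l(2) by auto
    then show False using coef_b[OF l(1)] by simp
  qed
  have sp: "alg.span (b ` G) = range (\<lambda>x. idem \<pi> a * x)"
  proof
    have sub: "alg.subspace (range (\<lambda>x. idem \<pi> a * x))"
      unfolding alg.subspace_def
      by (auto simp: scale_mult(2)[symmetric] distrib_left[symmetric] intro: range_eqI[of _ _ 0])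
    have "b l = idem \<pi> a * b l" for l
      using a pth_mult[of "int a" 0 "int a" l] by (simp add: b_pth vx_of_nat idem_def pth_vx)
    then show "alg.span (b ` G) \<subseteq> range (\<lambda>x. idem \<pi> a * x)"
      by (intro alg.span_minimal sub) auto
    have "idem \<pi> a * x \<in> alg.span (b ` G)" for x
    proof (induction x rule: alg_induct)
      case (path t l)
      have "idem \<pi> a * pth t l \<in> {0, b l}"
        using a pth_mult[of "int a" 0 t l]
        by (simp add: b_pth vx_of_nat idem_def pth_vx)
      moreover have "b l \<in> alg.span (b ` G)"
      proof (cases "l \<in> G")
        case False
        then have "b l = 0" using a by (simp add: G_def b_def pi_bad)
        then show ?thesis by (simp add: alg.span_zero)
      qed (auto intro: alg.span_base)
      ultimately show ?case by (auto intro: alg.span_zero)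
    qed (auto simp: distrib_left scale_mult intro: alg.span_add alg.span_scale)
    then show "range (\<lambda>x. idem \<pi> a * x) \<subseteq> alg.span (b ` G)" by auto
  qed
  obtain B where B: "finite B" "alg.span B = UNIV"
    using nakayama by (auto simp: nakayama_algebra_def fd_algebra_def)
  have "finite (b ` G)" using alg.independent_span_bound[OF B(1) indep] B(2) by auto
  then have fin: "finite G" using inj finite_imageD by blast
  have card: "dim_proj scale \<pi> a = card G"
    unfolding dim_proj_def sp[symmetric] alg.dim_span alg.dim_eq_card_independent[OF indep]
    by (rule card_image[OF inj])
  have down: "m \<in> G" if "l \<in> G" "m \<le> l" for l m
    using that bad_right[of a m "l - m"] by (auto simp: G_def)
  have "G = {..<card G}"
  proof (rule card_subset_eq[symmetric])
    show "{..<card G} \<subseteq> G"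
    proof (rule ccontr)
      assume "\<not> {..<card G} \<subseteq> G"
      then obtain m where m: "m < card G" "m \<notin> G" by auto
      then have "G \<subseteq> {..<m}" using down by (meson lessThan_iff linorder_not_le subsetI)
      then have "card G \<le> m" using card_mono[of "{..<m}" G] by simp
      with m show False by simp
    qed
  qed (use fin in auto)
  then show ?thesis unfolding card G_def by blast
qed

text \<open>The Kupisch inequality holds because a nonzero path stays nonzero when its first arrow
  is cut off.\<close>

sublocale cyclic_lengths n "dim_proj scale \<pi>"
proof
  show "n \<ge> 1" by (rule n_ge1)
next
  fix a assume a: "a \<in> verts n"
  show p1: "dim_proj scale \<pi> a \<ge> 1" using bad_iff_dim[OF a, of 0] not_bad_0 by (simp add: Suc_le_eq)
  show "dim_proj scale \<pi> a \<le> dim_proj scale \<pi> (rot n a) + 1"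
  proof (rule ccontr)
    assume "\<not> dim_proj scale \<pi> a \<le> dim_proj scale \<pi> (rot n a) + 1"
    then have "\<not> bad (a, 1 + dim_proj scale \<pi> (rot n a))" using bad_iff_dim[OF a] by simp
    then have "\<not> bad ((rot n ^^ 1) a, dim_proj scale \<pi> (rot n a))" using bad_left by blast
    then show False using bad_iff_dim[OF rot_pow_verts[OF a, of 1]] by simp
  qed
qed

lemma bad_vx_iff: "bad (vx n t, l) \<longleftrightarrow> F t \<le> t + int l"
  using bad_iff_dim[OF vx_in_verts[OF n_ge1], of t l] by (auto simp: F_def)

lemma pth_zero: "F t \<le> t + int l \<Longrightarrow> pth t l = 0"
  unfolding pth_def by (intro pi_bad vx_in_verts n_ge1) (simp add: bad_vx_iff)

lemma one_sum: "1 = (\<Sum>a\<in>verts n. pth (int a) 0)"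
proof -
  let ?s = "\<lambda>A. \<Sum>a\<in>A. path_vec (a, 0) :: nat \<times> nat \<Rightarrow> 'k"
  have "finite A \<Longrightarrow> A \<subseteq> verts n \<Longrightarrow>
      ?s A \<in> path_algebra n \<and>
      \<pi> (?s A) = (\<Sum>a\<in>A. pth (int a) 0)" for A
  proof (induction A rule: finite_induct)
    case (insert a A)
    then have "(path_vec (a, 0) :: nat \<times> nat \<Rightarrow> 'k) \<in> path_algebra n" "a \<in> verts n"
      by (auto intro: path_algebra_path_vec)
    moreover from insert have "?s A \<in> path_algebra n"
      "\<pi> (?s A) = (\<Sum>a\<in>A. pth (int a) 0)" by auto
    ultimately show ?case
      unfolding sum.insert[OF insert.hyps] by (simp only: path_algebra_add pi_add pth_vx simp_thms)
  qed (simp only: sum.empty pi_zero path_algebra_zero)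
  from this[of "verts n"] show ?thesis using pi_one by (simp add: path_one_def verts_def)
qed

end

section \<open>Modules\<close>

lemma sum_fun_apply: "(\<Sum>a\<in>A. f a) q = (\<Sum>a\<in>A. f a q)"
  for f :: "'b \<Rightarrow> 'c \<Rightarrow> 'd::comm_monoid_add"
  by (induction A rule: infinite_finite_induct) (auto simp: plus_fun_apply zero_fun_apply)

lemma seq_scale_apply: "seq_scale c v q = c * v q"
  by (simp add: seq_scale_def)

text \<open>As rewrite rules these would eta-expand every sum of sequences.\<close>

declare plus_fun_apply [simp del] zero_fun_apply [simp del] minus_apply [simp del]

lemmas seq_apply = plus_fun_apply zero_fun_apply seq_scale_apply

interpretation seq_pair: vector_space_pair "seq_scale :: 'k::field \<Rightarrow> _" "seq_scale :: 'k \<Rightarrow> _"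
  by unfold_locales

text \<open>Module maps are linear only on a carrier. Once extended to all sequences they admit the
  linear left inverse on which \<open>interval_injective\<close> rests.\<close>

lemma linear_extension:
  fixes f :: "(nat \<Rightarrow> 'k::field) \<Rightarrow> (nat \<Rightarrow> 'k)"
  assumes V: "seq.subspace V"
    and add: "\<And>v w. v \<in> V \<Longrightarrow> w \<in> V \<Longrightarrow> f (v + w) = f v + f w"
    and sc: "\<And>c v. v \<in> V \<Longrightarrow> f (seq_scale c v) = seq_scale c (f v)"
  obtains L where "Vector_Spaces.linear seq_scale seq_scale L" "\<And>v. v \<in> V \<Longrightarrow> L v = f v"
proof -
  obtain B where B: "B \<subseteq> V" "seq.independent B" "V \<subseteq> seq.span B"
    using seq.basis_exists[of V] by metis
  obtain L where L: "Vector_Spaces.linear seq_scale seq_scale L" "\<forall>b\<in>B. L b = f b"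
    using seq_pair.linear_independent_extend[OF B(2)] by metis
  interpret L: Vector_Spaces.linear seq_scale seq_scale L by (rule L)
  have "v \<in> V \<and> L v = f v" if "v \<in> seq.span B" for v
    using that
  proof (induction rule: seq.span_induct_alt)
    case base
    have "f 0 = f 0 + f 0" using add[of 0 0] seq.subspace_0[OF V] by simp
    then show ?case using seq.subspace_0[OF V] by (simp add: L.zero)
  next
    case (step c x y)
    then have y: "y \<in> V" "x \<in> V" "seq_scale c x \<in> V"
      using B(1) seq.subspace_scale[OF V] by auto
    then have "seq_scale c x + y \<in> V" by (intro seq.subspace_add[OF V])
    then show ?case using y step L(2) by (simp add: L.add L.scale add sc)
  qed
  then show thesis using that L(1) B(3) by blast
qed

section \<open>Actions of paths and homomorphisms\<close>

context nakayama
begin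

context
  fixes M :: "('k, 'a) rmod"
  assumes M: "fd_module scale M"
begin

lemma carrier_subspace: "seq.subspace (carrier M)"
  and act_closed: "v \<in> carrier M \<Longrightarrow> act M v x \<in> carrier M"
  and act_add: "v \<in> carrier M \<Longrightarrow> w \<in> carrier M \<Longrightarrow> act M (v + w) x = act M v x + act M w x"
  and act_add_right: "v \<in> carrier M \<Longrightarrow> act M v (x + y) = act M v x + act M v y"
  and act_mult: "v \<in> carrier M \<Longrightarrow> act M (act M v x) y = act M v (x * y)"
  and act_one: "v \<in> carrier M \<Longrightarrow> act M v 1 = v"
  and act_scale_right: "v \<in> carrier M \<Longrightarrow> act M v (scale c x) = seq_scale c (act M v x)"
  using M unfolding fd_module_def by auto

text \<open>Scalars act through the central elements \<open>scale c 1\<close>. The same device makes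
  every homomorphism linear over the field.\<close>

lemma act_scale: "v \<in> carrier M \<Longrightarrow> act M (seq_scale c v) x = seq_scale c (act M v x)"
proof -
  assume v: "v \<in> carrier M"
  have "act M (seq_scale c v) x = act M (act M v (scale c 1)) x"
    unfolding act_scale_right[OF v] act_one[OF v] ..
  also have "\<dots> = seq_scale c (act M v x)"
    using act_mult[OF v, of "scale c 1" x] act_scale_right[OF v, of c x]
    by (simp only: scale_mult mult_1_left)
  finally show ?thesis .
qed

lemma act_zero_right: "v \<in> carrier M \<Longrightarrow> act M v 0 = 0"
  using act_add_right[of v 0 0] by simp

lemma carrier_0: "0 \<in> carrier M"
  using seq.subspace_0[OF carrier_subspace] .

lemma carrier_diff: "v \<in> carrier M \<Longrightarrow> w \<in> carrier M \<Longrightarrow> v - w \<in> carrier M"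
  using seq.subspace_diff[OF carrier_subspace] .

lemma act_zero: "act M 0 x = 0"
  using act_add[OF carrier_0 carrier_0, of x] by simp

lemma act_diff: "v \<in> carrier M \<Longrightarrow> w \<in> carrier M \<Longrightarrow> act M (v - w) x = act M v x - act M w x"
  using act_add[of "v - w" w x] carrier_diff[of v w] by (simp add: algebra_simps)

lemma act_sum_left:
  assumes "\<And>t. t \<in> A \<Longrightarrow> w t \<in> carrier M"
  shows "act M (\<Sum>t\<in>A. w t) x = (\<Sum>t\<in>A. act M (w t) x)"
proof -
  have "(\<Sum>t\<in>A. w t) \<in> carrier M \<and> act M (\<Sum>t\<in>A. w t) x = (\<Sum>t\<in>A. act M (w t) x)"
    using assms
  proof (induction A rule: infinite_finite_induct)
    case (insert a A)
    have "sum w A \<in> carrier M \<and> act M (sum w A) x = (\<Sum>t\<in>A. act M (w t) x)"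
      using insert by simp
    moreover have "w a \<in> carrier M" using insert by simp
    ultimately show ?case unfolding sum.insert[OF insert.hyps]
      using seq.subspace_add[OF carrier_subspace] act_add by simp
  qed (simp_all only: sum.infinite sum.empty carrier_0 act_zero simp_thms)
  then show ?thesis ..
qed

lemma act_sum_right:
  assumes "v \<in> carrier M"
  shows "act M v (\<Sum>t\<in>A. x t) = (\<Sum>t\<in>A. act M v (x t))"
  by (induction A rule: infinite_finite_induct) (simp_all add: act_zero_right act_add_right assms)

lemma act_pth:
  "v \<in> carrier M \<Longrightarrow> act M (act M v (pth t l)) (pth s m) =
     (if vx n (t + int l) = vx n s then act M v (pth t (l + m)) else 0)"
  by (simp add: act_mult pth_mult act_zero_right)

end

lemma hom_closed: "mod_hom M N f \<Longrightarrow> v \<in> carrier M \<Longrightarrow> f v \<in> carrier N"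
  and hom_add: "mod_hom M N f \<Longrightarrow> v \<in> carrier M \<Longrightarrow> w \<in> carrier M \<Longrightarrow> f (v + w) = f v + f w"
  and hom_act: "mod_hom M N f \<Longrightarrow> v \<in> carrier M \<Longrightarrow> f (act M v x) = act N (f v) x"
  by (auto simp: mod_hom_def)

lemma hom_zero: "fd_module scale M \<Longrightarrow> mod_hom M N f \<Longrightarrow> f 0 = 0"
  using hom_add[of M N f 0 0] carrier_0[of M] by simp

lemma hom_diff:
  "fd_module scale M \<Longrightarrow> mod_hom M N f \<Longrightarrow> v \<in> carrier M \<Longrightarrow> w \<in> carrier M \<Longrightarrow> f (v - w) = f v - f w"
  using hom_add[of M N f "v - w" w] carrier_diff[of M v w] by (simp add: algebra_simps)

lemma hom_scale:
  assumes "fd_module scale M" "fd_module scale N" "mod_hom M N f" "v \<in> carrier M"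
  shows "f (seq_scale c v) = seq_scale c (f v)"
proof -
  have "f (seq_scale c v) = f (act M v (scale c 1))" using assms by (simp add: act_scale_right act_one)
  also have "\<dots> = act N (f v) (scale c 1)" using assms by (intro hom_act)
  also have "\<dots> = seq_scale c (f v)"
    using assms hom_closed[OF assms(3,4)] by (simp add: act_scale_right act_one)
  finally show ?thesis .
qed

lemma mod_homI:
  assumes M: "fd_module scale M" and N: "fd_module scale N"
    and cl: "\<And>v. v \<in> carrier M \<Longrightarrow> f v \<in> carrier N"
    and add: "\<And>v w. v \<in> carrier M \<Longrightarrow> w \<in> carrier M \<Longrightarrow> f (v + w) = f v + f w"
    and sc: "\<And>c v. v \<in> carrier M \<Longrightarrow> f (seq_scale c v) = seq_scale c (f v)"
    and pth: "\<And>v t l. v \<in> carrier M \<Longrightarrow> f (act M v (pth t l)) = act N (f v) (pth t l)"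
  shows "mod_hom M N f"
proof -
  have "f (act M v x) = act N (f v) x" if v: "v \<in> carrier M" for v x
  proof (induction x rule: alg_induct)
    case (add x y)
    then show ?case using v cl[OF v] assms(4) by (simp add: act_add_right M N act_closed)
  next
    case (scale c x)
    then show ?case using v cl[OF v] sc by (simp add: act_scale_right M N act_closed)
  qed (simp add: pth v)
  then show ?thesis using cl add by (auto simp: mod_hom_def)
qed

subsection \<open>Interval modules\<close>

text \<open>A sequence \<open>v\<close> is read as a function on the integers via the bijection \<open>int_encode\<close>. The module
  \<open>interval i j\<close> has one basis vector at every integer position \<open>t\<close> with \<open>i \<le> t < j\<close>, placed at the
  vertex \<open>vx n t\<close>, and the arrows move position \<open>t\<close> to position \<open>t + 1\<close>.\<close>

definition interval :: "int \<Rightarrow> int \<Rightarrow> ('k, 'a) rmod" where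
  "interval i j = \<lparr>
     carrier = {v. \<forall>t. v (int_encode t) \<noteq> 0 \<longrightarrow> i \<le> t \<and> t < j},
     act = (\<lambda>v x q. if int_decode q < j
       then \<Sum>s\<in>{i..int_decode q}. v (int_encode s) * coef x (vx n s, nat (int_decode q - s)) else 0)\<rparr>"

lemma seq_eqI: "(\<And>t. v (int_encode t) = w (int_encode t)) \<Longrightarrow> v = w"
  by (rule ext) (metis int_decode_inverse)

lemma interval_carrier: "v \<in> carrier (interval i j) \<longleftrightarrow> (\<forall>t. v (int_encode t) \<noteq> 0 \<longrightarrow> i \<le> t \<and> t < j)"
  by (simp add: interval_def)

lemma interval_carrier_zero: "v \<in> carrier (interval i j) \<Longrightarrow> \<not> (i \<le> t \<and> t < j) \<Longrightarrow> v (int_encode t) = 0"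
  by (auto simp: interval_carrier)

lemma interval_act: "act (interval i j) v x (int_encode t) =
    (if t < j then \<Sum>s\<in>{i..t}. v (int_encode s) * coef x (vx n s, nat (t - s)) else 0)"
  by (simp add: interval_def)

text \<open>This is where \<open>j \<le> F i\<close> enters the construction: every path inside the
  interval is nonzero, so its coefficient is well defined.\<close>

lemma interval_not_bad:
  assumes "j \<le> F i" "i \<le> s" "s \<le> t" "t < j"
  shows "\<not> bad (vx n s, nat (t - s))"
  using assms monoD[OF F_mono assms(2)] by (simp add: bad_vx_iff)

lemma interval_act_pth:
  assumes "j \<le> F i"
  shows "act (interval i j) v (pth c l) (int_encode t) =
    (if t < j \<and> i \<le> t - int l \<and> vx n (t - int l) = vx n c then v (int_encode (t - int l)) else 0)"
proof (cases "t < j")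
  case True
  have "(\<Sum>s\<in>{i..t}. v (int_encode s) * coef (pth c l) (vx n s, nat (t - s))) =
      (\<Sum>s\<in>{i..t}. if s = t - int l then (if vx n s = vx n c then v (int_encode s) else 0) else 0)"
    using interval_not_bad[OF assms _ _ True] by (intro sum.cong) (auto simp: coef_pth)
  then show ?thesis using True by (simp add: interval_act)
qed (simp add: interval_act)

definition unit_seq :: "int \<Rightarrow> nat \<Rightarrow> 'k" where
  "unit_seq t q = (if q = int_encode t then 1 else 0)"

lemma unit_seq_apply: "unit_seq t (int_encode s) = (if s = t then 1 else 0)"
  by (auto simp: unit_seq_def inj_eq[OF inj_int_encode])

lemma unit_seq_in: "i \<le> t \<Longrightarrow> t < j \<Longrightarrow> unit_seq t \<in> carrier (interval i j)"
  by (auto simp: interval_carrier unit_seq_apply)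

lemma interval_subspace: "seq.subspace (carrier (interval i j))"
proof -
  have "i \<le> t \<and> t < j" if vw: "v \<in> carrier (interval i j)" "w \<in> carrier (interval i j)"
    "v (int_encode t) + w (int_encode t) \<noteq> 0" for v w t
  proof (rule ccontr)
    assume "\<not> (i \<le> t \<and> t < j)"
    then have "v (int_encode t) = 0" "w (int_encode t) = 0"
      using vw(1,2) interval_carrier_zero by blast+
    with vw(3) show False by simp
  qed
  then have "v + w \<in> carrier (interval i j)"
    if "v \<in> carrier (interval i j)" "w \<in> carrier (interval i j)" for v w
    using that unfolding interval_carrier[of "v + w"] plus_fun_apply by blast
  moreover have "seq_scale c v \<in> carrier (interval i j)" if "v \<in> carrier (interval i j)" for c v
    using that unfolding interval_carrier seq_scale_apply by simp
  moreover have "0 \<in> carrier (interval i j)" by (simp add: interval_carrier zero_fun_apply)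
  ultimately show ?thesis unfolding seq.subspace_def by blast
qed

lemma interval_fd_module:
  assumes j: "j \<le> F i"
  shows "fd_module scale (interval i j)"
  unfolding fd_module_def
proof (intro conjI ballI allI)
  let ?I = "interval i j"
  show "seq.subspace (carrier ?I)" by (rule interval_subspace)
  show "\<exists>B. finite B \<and> carrier ?I = seq.span B"
  proof (intro exI conjI)
    show "finite (unit_seq ` {i..<j})" by simp
    show "carrier ?I = seq.span (unit_seq ` {i..<j})"
    proof
      show "seq.span (unit_seq ` {i..<j}) \<subseteq> carrier ?I"
        by (intro seq.span_minimal interval_subspace) (auto intro: unit_seq_in)
      show "carrier ?I \<subseteq> seq.span (unit_seq ` {i..<j})"
      proof
        fix v assume v: "v \<in> carrier ?I"
        have "v = (\<Sum>t\<in>{i..<j}. seq_scale (v (int_encode t)) (unit_seq t))"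
        proof (rule seq_eqI)
          fix t
          have "(\<Sum>s\<in>{i..<j}. seq_scale (v (int_encode s)) (unit_seq s)) (int_encode t) =
              (\<Sum>s\<in>{i..<j}. if s = t then v (int_encode t) else 0)"
            unfolding sum_fun_apply by (intro sum.cong) (auto simp: unit_seq_apply seq_apply)
          then show "v (int_encode t) = (\<Sum>s\<in>{i..<j}. seq_scale (v (int_encode s)) (unit_seq s)) (int_encode t)"
            using interval_carrier_zero[OF v, of t] by auto
        qed
        also have "\<dots> \<in> seq.span (unit_seq ` {i..<j})"
          by (intro seq.span_sum seq.span_scale seq.span_base) auto
        finally show "v \<in> seq.span (unit_seq ` {i..<j})" .
      qed
    qed
  qed
  fix v assume v: "v \<in> carrier ?I"
  show "act ?I v x \<in> carrier ?I" for x
  proof -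
    have "act ?I v x (int_encode t) = 0" if "\<not> (i \<le> t \<and> t < j)" for t
      using that by (auto simp: interval_act)
    then show ?thesis unfolding interval_carrier[of "act ?I v x"] by blast
  qed
  show "act ?I (v + w) x = act ?I v x + act ?I w x" for w x
    by (rule seq_eqI) (simp add: interval_act distrib_right sum.distrib seq_apply)
  show "act ?I v (x + y) = act ?I v x + act ?I v y" for x y
    by (rule seq_eqI)
      (auto simp: seq_apply interval_act interval_not_bad[OF j] coef_add distrib_left sum.distrib[symmetric] intro!: sum.cong)
  show "act ?I v (scale c x) = seq_scale c (act ?I v x)" for c x
    by (rule seq_eqI)
      (auto simp: seq_apply interval_act interval_not_bad[OF j] coef_scale sum_distrib_left mult_ac intro!: sum.cong)
  show "act ?I v 1 = v"
  proof (rule seq_eqI)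
    fix t
    have "(\<Sum>s\<in>{i..t}. v (int_encode s) * coef 1 (vx n s, nat (t - s))) =
        (\<Sum>s\<in>{i..t}. if s = t then v (int_encode t) else 0)" if "t < j"
      using interval_not_bad[OF j _ _ that]
      by (intro sum.cong) (auto simp: coef_one vx_in_verts[OF n_ge1])
    then have "act ?I v 1 (int_encode t) = (if i \<le> t \<and> t < j then v (int_encode t) else 0)"
      by (simp add: interval_act)
    then show "act ?I v 1 (int_encode t) = v (int_encode t)"
      using interval_carrier_zero[OF v, of t] by auto
  qed
  show "act ?I v (x * y) = act ?I (act ?I v x) y" for x y
  proof (rule seq_eqI)
    fix t
    show "act ?I v (x * y) (int_encode t) = act ?I (act ?I v x) y (int_encode t)"
    proof (cases "t < j")
      case True
      let ?g = "\<lambda>s r. v (int_encode s) * (coef x (vx n s, nat (r - s)) * coef y (vx n r, nat (t - r)))"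
      have "act ?I v (x * y) (int_encode t) =
          (\<Sum>s\<in>{i..t}. v (int_encode s) * coef (x * y) (vx n s, nat (t - s)))"
        using True by (simp add: interval_act)
      \<comment> \<open>Both sides sum over chains \<open>i \<le> s \<le> r \<le> t\<close>, where
        \<open>r\<close> is the position reached by \<open>x\<close>; only the order of summation
        differs.\<close>
      also have "\<dots> = (\<Sum>s\<in>{i..t}. \<Sum>r\<in>{r\<in>{i..t}. s \<le> r}. ?g s r)"
      proof (rule sum.cong)
        fix s assume s: "s \<in> {i..t}"
        then have "coef (x * y) (vx n s, nat (t - s)) =
            (\<Sum>k\<le>nat (t - s). coef x (vx n s, k) * coef y (vx n (s + int k), nat (t - s) - k))"
          using interval_not_bad[OF j _ _ True] by (simp add: coef_mult rot_pow_vx[OF n_ge1])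
        also have "\<dots> = (\<Sum>r\<in>{r\<in>{i..t}. s \<le> r}. coef x (vx n s, nat (r - s)) * coef y (vx n r, nat (t - r)))"
        proof (rule sum.reindex_bij_witness[of _ "\<lambda>r. nat (r - s)" "\<lambda>k. s + int k"])
          fix k assume k: "k \<in> {..nat (t - s)}"
          then have "nat (t - (s + int k)) = nat (t - s) - k" by auto
          then show "coef x (vx n s, nat (s + int k - s)) * coef y (vx n (s + int k), nat (t - (s + int k))) =
             coef x (vx n s, k) * coef y (vx n (s + int k), nat (t - s) - k)" by simp
        qed (use s in auto)
        finally show "v (int_encode s) * coef (x * y) (vx n s, nat (t - s)) = (\<Sum>r\<in>{r\<in>{i..t}. s \<le> r}. ?g s r)"
          by (simp only: sum_distrib_left)
      qed simp
      also have "\<dots> = (\<Sum>r\<in>{i..t}. \<Sum>s\<in>{s\<in>{i..t}. s \<le> r}. ?g s r)"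
        by (rule sum.swap_restrict) auto
      also have "\<dots> = (\<Sum>r\<in>{i..t}. act ?I v x (int_encode r) * coef y (vx n r, nat (t - r)))"
      proof (rule sum.cong)
        fix r assume r: "r \<in> {i..t}"
        then have "{s\<in>{i..t}. s \<le> r} = {i..r}" by auto
        then show "(\<Sum>s\<in>{s\<in>{i..t}. s \<le> r}. ?g s r) = act ?I v x (int_encode r) * coef y (vx n r, nat (t - r))"
          using r True by (simp add: interval_act sum_distrib_right mult.assoc)
      qed simp
      also have "\<dots> = act ?I (act ?I v x) y (int_encode t)"
        using True by (simp add: interval_act)
      finally show ?thesis .
    qed (simp add: interval_act)
  qed
qed

text \<open>A homomorphism into \<open>interval i j\<close> is determined by its coordinate at the socle position
  \<open>j - 1\<close>, and, as no path of length at least \<open>j - i\<close> ending there is nonzero, every linear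
  functional on the component at the vertex of \<open>j - 1\<close> arises in this way. So extending a
  homomorphism means extending a linear functional.\<close>

lemma interval_injective:
  assumes ij: "i < j" and j: "j \<le> F i" and i: "F (i - 1) < j"
  shows "injective_module scale (interval i j)"
  unfolding injective_module_def
proof (intro conjI allI impI; (elim conjE)?)
  let ?I = "interval i j"
  show fdI: "fd_module scale ?I" using j by (rule interval_fd_module)
  fix X Y \<iota> g
  assume X: "fd_module scale X" and Y: "fd_module scale Y" and \<iota>: "mod_hom X Y \<iota>"
    and inj: "inj_on \<iota> (carrier X)" and g: "mod_hom X ?I g"
  obtain \<iota>' where \<iota>': "Vector_Spaces.linear seq_scale seq_scale \<iota>'" "\<And>v. v \<in> carrier X \<Longrightarrow> \<iota>' v = \<iota> v"
    using linear_extension[OF carrier_subspace[OF X], of \<iota>] hom_add[OF \<iota>] hom_scale[OF X Y \<iota>] by blast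
  obtain g' where g': "Vector_Spaces.linear seq_scale seq_scale g'" "\<And>v. v \<in> carrier X \<Longrightarrow> g' v = g v"
    using linear_extension[OF carrier_subspace[OF X], of g] hom_add[OF g] hom_scale[OF X fdI g] by blast
  have "inj_on \<iota>' (carrier X)" using inj \<iota>'(2) by (simp add: inj_on_def)
  then obtain \<psi> where \<psi>: "Vector_Spaces.linear seq_scale seq_scale \<psi>" "\<And>v. v \<in> carrier X \<Longrightarrow> \<psi> (\<iota>' v) = v"
    using seq_pair.linear_exists_left_inverse_on[OF \<iota>'(1) carrier_subspace[OF X]] by blast
  interpret g': Vector_Spaces.linear seq_scale seq_scale g' by (rule g')
  interpret \<psi>: Vector_Spaces.linear seq_scale seq_scale \<psi> by (rule \<psi>)
  \<comment> \<open>The socle coordinate of \<open>g\<close>, extended from the image of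
    \<open>\<iota>\<close> to all of \<open>Y\<close> through a linear left inverse.\<close>
  define \<phi> where "\<phi> w = g' (\<psi> w) (int_encode (j - 1))" for w
  have \<phi>_add: "\<phi> (v + w) = \<phi> v + \<phi> w" and \<phi>_scale: "\<phi> (seq_scale c v) = c * \<phi> v"
    and \<phi>_zero: "\<phi> 0 = 0" for v w c
    by (simp_all add: \<phi>_def g'.add \<psi>.add g'.scale \<psi>.scale g'.zero \<psi>.zero seq_apply)
  have \<phi>_\<iota>: "\<phi> (\<iota> v) = g v (int_encode (j - 1))" if "v \<in> carrier X" for v
    using \<psi>(2)[OF that] g'(2)[OF that] \<iota>'(2)[OF that] by (simp add: \<phi>_def)
  \<comment> \<open>The coordinate at \<open>t\<close> equals the socle coordinate after moving
    along the path from \<open>t\<close> to \<open>j - 1\<close>, which forces this formula.\<close>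
  define h where "h w q = (if i \<le> int_decode q \<and> int_decode q < j
      then \<phi> (act Y w (pth (int_decode q) (nat (j - 1 - int_decode q)))) else 0)" for w q
  have h: "h w (int_encode t) = (if i \<le> t \<and> t < j then \<phi> (act Y w (pth t (nat (j - 1 - t)))) else 0)" for w t
    by (simp add: h_def)
  show "\<exists>h. mod_hom Y ?I h \<and> (\<forall>v\<in>carrier X. h (\<iota> v) = g v)"
  proof (intro exI conjI ballI)
    show "mod_hom Y ?I h"
    proof (rule mod_homI[OF Y fdI])
      fix v assume v: "v \<in> carrier Y"
      show "h v \<in> carrier ?I" by (auto simp: interval_carrier h)
      show "h (v + w) = h v + h w" if "w \<in> carrier Y" for w
        by (rule seq_eqI) (simp add: h act_add[OF Y v that] \<phi>_add seq_apply)
      show "h (seq_scale c v) = seq_scale c (h v)" for c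
        by (rule seq_eqI) (simp add: h act_scale[OF Y v] \<phi>_scale seq_apply)
      show "h (act Y v (pth c l)) = act ?I (h v) (pth c l)" for c l
      proof (rule seq_eqI)
        fix t
        show "h (act Y v (pth c l)) (int_encode t) = act ?I (h v) (pth c l) (int_encode t)"
        proof (cases "i \<le> t \<and> t < j \<and> vx n (t - int l) = vx n c")
          case True
          let ?m = "nat (j - 1 - t)"
          have vt: "vx n (c + int l) = vx n t"
            using True by (simp add: vx_eq_iff[OF n_ge1] algebra_simps dvd_diff_commute)
          have "h (act Y v (pth c l)) (int_encode t) = \<phi> (act Y v (pth c (l + ?m)))"
            unfolding h act_pth[OF Y v] using vt True by (simp only: if_True simp_thms)
          also have "pth c (l + ?m) = pth (t - int l) (l + ?m)" using True pth_cong by metis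
          also have "\<phi> (act Y v (pth (t - int l) (l + ?m))) = act ?I (h v) (pth c l) (int_encode t)"
          proof (cases "i \<le> t - int l")
            case le: True
            have "nat (j - 1 - (t - int l)) = l + ?m" using True by auto
            then show ?thesis using True le by (simp add: interval_act_pth[OF j] h)
          next
            case False
            \<comment> \<open>Here \<open>F (i - 1) < j\<close> enters: a path to
              \<open>j - 1\<close> that starts left of \<open>i\<close> is zero.\<close>
            then have "F (t - int l) \<le> F (i - 1)" by (intro monoD[OF F_mono]) auto
            then have "pth (t - int l) (l + ?m) = 0" using i True by (intro pth_zero) auto
            then show ?thesis using False by (simp add: interval_act_pth[OF j] act_zero_right[OF Y v] \<phi>_zero)
          qed
          finally show ?thesis .
        next
          case False
          then have "i \<le> t \<Longrightarrow> t < j \<Longrightarrow> vx n (c + int l) \<noteq> vx n t"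
            by (simp add: vx_eq_iff[OF n_ge1] algebra_simps dvd_diff_commute)
          then have "h (act Y v (pth c l)) (int_encode t) = 0"
            by (simp add: h act_pth[OF Y v] \<phi>_zero)
          then show ?thesis using False by (auto simp: interval_act_pth[OF j])
        qed
      qed
    qed
    fix v assume v: "v \<in> carrier X"
    show "h (\<iota> v) = g v"
    proof (rule seq_eqI)
      fix t
      show "h (\<iota> v) (int_encode t) = g v (int_encode t)"
      proof (cases "i \<le> t \<and> t < j")
        case True
        have "h (\<iota> v) (int_encode t) = \<phi> (\<iota> (act X v (pth t (nat (j - 1 - t)))))"
          using True by (simp add: h hom_act[OF \<iota> v])
        also have "\<dots> = act ?I (g v) (pth t (nat (j - 1 - t))) (int_encode (j - 1))"
          using act_closed[OF X v] by (simp add: \<phi>_\<iota> hom_act[OF g v])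
        also have "\<dots> = g v (int_encode t)" using True by (simp add: interval_act_pth[OF j])
        finally show ?thesis .
      next
        case False
        then show ?thesis using interval_carrier_zero[OF hom_closed[OF g v], of t] by (auto simp: h)
      qed
    qed
  qed
qed

subsection \<open>Lower bound for the injective dimension\<close>

text \<open>For a module \<open>A\<close> with underlying set \<open>Z\<close> this is exactness at the middle term of the complex
  \<open>Z e\<^sub>i \<rightarrow> Z e\<^sub>j \<rightarrow> Z e\<^sub>k\<close> given by the right multiplications with paths. Since \<open>Hom(P\<^sub>i, A) = A e\<^sub>i\<close>,
  such complexes compute the extensions by \<open>A\<close> of the interval modules.\<close>

definition exact_at :: "('k, 'a) rmod \<Rightarrow> (nat \<Rightarrow> 'k) set \<Rightarrow> int \<Rightarrow> int \<Rightarrow> int \<Rightarrow> bool" where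
  "exact_at A Z i j k \<longleftrightarrow> (\<forall>v\<in>Z. act A v (pth j 0) = v \<and> act A v (pth j (nat (k - j))) = 0 \<longrightarrow>
     (\<exists>u\<in>Z. act A u (pth i 0) = u \<and> act A u (pth i (nat (j - i))) = v))"

lemma exact_atE:
  assumes "exact_at A Z i j k" "v \<in> Z" "act A v (pth j 0) = v" "act A v (pth j (nat (k - j))) = 0"
  obtains u where "u \<in> Z" "act A u (pth i 0) = u" "act A u (pth i (nat (j - i))) = v"
  using assms unfolding exact_at_def by blast

lemma interval_inclusion:
  assumes k: "k \<le> F i" and ij: "i \<le> j"
  shows "mod_hom (interval j k) (interval i k) (\<lambda>v. v)"
proof (rule mod_homI)
  have k': "k \<le> F j" using k monoD[OF F_mono ij] by simp
  then show "fd_module scale (interval j k)" by (rule interval_fd_module)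
  show "fd_module scale (interval i k)" using k by (rule interval_fd_module)
  fix v assume v: "v \<in> carrier (interval j k)"
  show "v \<in> carrier (interval i k)" using v ij unfolding interval_carrier by (meson order_trans)
  show "act (interval j k) v (pth c l) = act (interval i k) v (pth c l)" for c l
  proof (rule seq_eqI)
    fix t
    show "act (interval j k) v (pth c l) (int_encode t) = act (interval i k) v (pth c l) (int_encode t)"
      using interval_carrier_zero[OF v, of "t - int l"] ij by (auto simp: interval_act_pth k k')
  qed
qed auto

text \<open>\<open>interval j k\<close> is the quotient of the projective module at \<open>j\<close>
  by the path from \<open>j\<close> to \<open>k\<close>. So an element killed by that path defines a
  homomorphism, with the generator sent to \<open>v e_j\<close>.\<close>

lemma interval_path_hom:
  assumes M: "fd_module scale M" and j: "k \<le> F j"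
    and v: "v \<in> carrier M" "act M v (pth j (nat (k - j))) = 0" and jk: "j \<le> k"
  shows "mod_hom (interval j k) M
    (\<lambda>w. \<Sum>t\<in>{j..<k}. seq_scale (w (int_encode t)) (act M v (pth j (nat (t - j)))))"
    (is "mod_hom _ _ ?g")
proof (rule mod_homI)
  let ?X = "interval j k"
  let ?b = "\<lambda>t. act M v (pth j (nat (t - j)))"
  note sub = carrier_subspace[OF M]
  have b: "?b t \<in> carrier M" for t by (rule act_closed[OF M v(1)])
  show "fd_module scale ?X" using j by (rule interval_fd_module)
  show "fd_module scale M" by (rule M)
  fix w assume w: "w \<in> carrier ?X"
  show "?g w \<in> carrier M" by (intro seq.subspace_sum[OF sub] seq.subspace_scale[OF sub] b)
  show "?g (w + w') = ?g w + ?g w'" for w'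
    by (simp only: plus_fun_apply seq.scale_left_distrib sum.distrib)
  show "?g (seq_scale c w) = seq_scale c (?g w)" for c
    by (simp only: seq_scale_apply seq.scale_scale[symmetric] seq.scale_sum_right)
  show "?g (act ?X w (pth c l)) = act M (?g w) (pth c l)" for c l
  proof -
    have b0: "?b t = 0" if "t \<ge> k" for t
    proof -
      have "vx n (j + int (nat (k - j))) = vx n k" using jk by simp
      then have "act M (act M v (pth j (nat (k - j)))) (pth k (nat (t - k))) =
          act M v (pth j (nat (k - j) + nat (t - k)))"
        by (simp only: act_pth[OF M v(1)] if_True simp_thms)
      moreover have "nat (k - j) + nat (t - k) = nat (t - j)" using that jk by simp
      ultimately show ?thesis using v(2) act_zero[OF M] by simp
    qed
    have step: "act M (?b s) (pth c l) = (if vx n s = vx n c then ?b (s + int l) else 0)" if "j \<le> s" for s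
    proof -
      have "vx n (j + int (nat (s - j))) = vx n s" "nat (s - j) + l = nat (s + int l - j)"
        using that by auto
      then show ?thesis by (simp only: act_pth[OF M v(1)])
    qed
    let ?G = "\<lambda>s. if vx n s = vx n c then seq_scale (w (int_encode s)) (?b (s + int l)) else 0"
    have "?g (act ?X w (pth c l)) = (\<Sum>t\<in>{j..<k}. if j + int l \<le> t then ?G (t - int l) else 0)"
    proof (rule sum.cong)
      fix t assume t: "t \<in> {j..<k}"
      show "seq_scale (act ?X w (pth c l) (int_encode t)) (?b t) =
          (if j + int l \<le> t then ?G (t - int l) else 0)"
        using t by (auto simp: interval_act_pth[OF j])
    qed simp
    also have "\<dots> = (\<Sum>t\<in>{j + int l..<k}. ?G (t - int l))"
      by (rule sum.mono_neutral_cong_right) auto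
    also have "\<dots> = (\<Sum>s\<in>{j..<k - int l}. ?G s)"
      by (rule sum.reindex_bij_witness[of _ "\<lambda>s. s + int l" "\<lambda>t. t - int l"]) auto
    also have "\<dots> = (\<Sum>s\<in>{j..<k}. ?G s)"
      by (rule sum.mono_neutral_left) (auto simp: b0)
    also have "\<dots> = (\<Sum>s\<in>{j..<k}. act M (seq_scale (w (int_encode s)) (?b s)) (pth c l))"
      by (rule sum.cong) (auto simp: act_scale[OF M b] step)
    also have "\<dots> = act M (?g w) (pth c l)"
      by (rule act_sum_left[OF M, symmetric]) (intro seq.subspace_scale[OF sub] b)
    finally show ?thesis .
  qed
qed

text \<open>\<open>[i, F i)\<close> is the projective module at \<open>i\<close>. An element killed
  by the path from \<open>j\<close> to \<open>F i\<close> defines a homomorphism on the submodule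
  \<open>[j, F i)\<close>; injectivity extends it, and the image of the generator at
  \<open>i\<close>, cut down by \<open>e_i\<close>, is the required \<open>u\<close>.\<close>

lemma injective_exact:
  assumes M: "injective_module scale M" and ij: "i \<le> j" "j \<le> F i"
  shows "exact_at M (carrier M) i j (F i)"
  unfolding exact_at_def
proof (intro ballI impI; elim conjE)
  fix v assume v: "v \<in> carrier M" "act M v (pth j 0) = v" "act M v (pth j (nat (F i - j))) = 0"
  have fdM: "fd_module scale M" using M by (simp add: injective_module_def)
  show "\<exists>u\<in>carrier M. act M u (pth i 0) = u \<and> act M u (pth i (nat (j - i))) = v"
  proof (cases "j = F i")
    case True
    then have "v = 0" using v by simp
    then show ?thesis using carrier_0[OF fdM] act_zero[OF fdM] by (intro bexI[of _ 0]) auto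
  next
    case False
    let ?X = "interval j (F i)" and ?Y = "interval i (F i)"
    let ?g = "\<lambda>w. \<Sum>t\<in>{j..<F i}. seq_scale (w (int_encode t)) (act M v (pth j (nat (t - j))))"
    have Fj: "F i \<le> F j" by (rule monoD[OF F_mono ij(1)])
    have X: "fd_module scale ?X" and Y: "fd_module scale ?Y" using Fj by (auto intro: interval_fd_module)
    have incl: "mod_hom ?X ?Y (\<lambda>v. v)" using ij(1) by (intro interval_inclusion) auto
    have g: "mod_hom ?X M ?g" using ij(2) v(1,3) Fj fdM by (intro interval_path_hom)
    have "\<exists>h. mod_hom ?Y M h \<and> (\<forall>v\<in>carrier ?X. h v = ?g v)"
      using M X Y incl g inj_on_id2 unfolding injective_module_def by blast
    then obtain h where h: "mod_hom ?Y M h" "\<And>v. v \<in> carrier ?X \<Longrightarrow> h v = ?g v" by blast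
    have e: "unit_seq i \<in> carrier ?Y" "unit_seq j \<in> carrier ?X"
      using ij False F_gt[of i] by (auto intro: unit_seq_in)
    have act_e: "act ?Y (unit_seq i) (pth i (nat (j - i))) = unit_seq j"
    proof (rule seq_eqI)
      fix t
      show "act ?Y (unit_seq i) (pth i (nat (j - i))) (int_encode t) = unit_seq j (int_encode t)"
        using ij False by (auto simp: interval_act_pth[OF order_refl] unit_seq_apply)
    qed
    have "h (unit_seq j) = (\<Sum>t\<in>{j..<F i}. if t = j then v else 0)"
      unfolding h(2)[OF e(2)] by (rule sum.cong) (auto simp: unit_seq_apply v(2))
    then have hj: "h (unit_seq j) = v" using ij False by simp
    let ?u0 = "h (unit_seq i)"
    have u0: "?u0 \<in> carrier M" using hom_closed[OF h(1) e(1)] .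
    show ?thesis
    proof (intro bexI conjI)
      show "act M ?u0 (pth i 0) \<in> carrier M" using u0 by (rule act_closed[OF fdM])
      show "act M (act M ?u0 (pth i 0)) (pth i 0) = act M ?u0 (pth i 0)"
        by (simp add: act_pth[OF fdM u0])
      have "act M (act M ?u0 (pth i 0)) (pth i (nat (j - i))) = act M ?u0 (pth i (nat (j - i)))"
        by (simp add: act_pth[OF fdM u0])
      also have "\<dots> = h (act ?Y (unit_seq i) (pth i (nat (j - i))))" by (rule hom_act[OF h(1) e(1), symmetric])
      also have "\<dots> = v" unfolding act_e by (rule hj)
      finally show "act M (act M ?u0 (pth i 0)) (pth i (nat (j - i))) = v" .
    qed
  qed
qed

lemma act_pth_pth:
  assumes "fd_module scale M" "v \<in> carrier M" "i \<le> j" "j \<le> k"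
  shows "act M (act M v (pth i (nat (j - i)))) (pth j (nat (k - j))) = act M v (pth i (nat (k - i)))"
proof -
  have "vx n (i + int (nat (j - i))) = vx n j" "nat (j - i) + nat (k - j) = nat (k - i)"
    using assms(3,4) by auto
  then show ?thesis by (simp only: act_pth[OF assms(1,2)] if_True simp_thms)
qed

text \<open>The step of the dimension shift along an exact sequence \<open>0 \<rightarrow> Z \<rightarrow> M \<rightarrow> Z' \<rightarrow> 0\<close> with \<open>M\<close> injective.
  It works because the composite path from \<open>i\<close> to \<open>F i\<close> is zero.\<close>

lemma exact_shift:
  assumes M: "injective_module scale M" and N: "fd_module scale N" and f: "mod_hom M N f"
    and Z': "f ` carrier M = Z'"
    and ex: "exact_at N Z' i j (F i)" and ij: "i \<le> j" "j \<le> F i"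
  shows "exact_at M {v \<in> carrier M. f v = 0} j (F i) (F j)"
  unfolding exact_at_def
proof (intro ballI impI; elim conjE)
  have fdM: "fd_module scale M" using M by (simp add: injective_module_def)
  fix v assume v: "v \<in> {v \<in> carrier M. f v = 0}" "act M v (pth (F i) 0) = v"
    "act M v (pth (F i) (nat (F j - F i))) = 0"
  have Fj: "F i \<le> F j" by (rule monoD[OF F_mono ij(1)])
  obtain u where u: "u \<in> carrier M" "act M u (pth j 0) = u" "act M u (pth j (nat (F i - j))) = v"
    using exact_atE[OF injective_exact[OF M ij(2) Fj] _ v(2,3)] v(1) by blast
  have fu: "f u \<in> Z'" "act N (f u) (pth j 0) = f u" "act N (f u) (pth j (nat (F i - j))) = 0"
    using u v(1) Z' hom_act[OF f u(1), symmetric] by auto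
  then obtain w where w: "w \<in> Z'" "act N w (pth i 0) = w" "act N w (pth i (nat (j - i))) = f u"
    by (rule exact_atE[OF ex])
  obtain w' where w': "w' \<in> carrier M" "f w' = w" using w(1) Z' by blast
  let ?x = "act M w' (pth i (nat (j - i)))"
  \<comment> \<open>Subtracting \<open>?x\<close> moves \<open>u\<close> into the kernel of
    \<open>f\<close>, and the path from \<open>j\<close> to \<open>F i\<close> kills
    \<open>?x\<close>.\<close>
  let ?u = "u - ?x"
  have x: "?x \<in> carrier M" using w'(1) by (rule act_closed[OF fdM])
  have fx: "f ?x = f u" using hom_act[OF f w'(1)] w w'(2) by simp
  have "f ?u = 0" using hom_diff[OF fdM f u(1) x] fx by simp
  moreover have "?u \<in> carrier M" using u(1) x by (rule carrier_diff[OF fdM])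
  moreover have "act M ?x (pth j 0) = ?x"
    using act_pth_pth[OF fdM w'(1) ij(1) order_refl] by simp
  then have "act M ?u (pth j 0) = ?u" using act_diff[OF fdM u(1) x] u(2) by simp
  moreover have "act M ?x (pth j (nat (F i - j))) = 0"
    unfolding act_pth_pth[OF fdM w'(1) ij] using F_gt[of i] w'(1) pth_zero act_zero_right[OF fdM] by simp
  then have "act M ?u (pth j (nat (F i - j))) = v" using act_diff[OF fdM u(1) x] u(3) by simp
  ultimately show "\<exists>u\<in>{v \<in> carrier M. f v = 0}. act M u (pth j 0) = u \<and> act M u (pth j (nat (F i - j))) = v"
    by blast
qed

text \<open>The positions \<open>y k\<close> index a projective resolution of
  \<open>[y 0, y 1)\<close> with syzygies \<open>[y k, y (k + 1))\<close>; the conclusion is that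
  \<open>Ext^(d+1)([y 0, y 1), M)\<close> vanishes.\<close>

lemma resolution_exact:
  assumes M: "fd_module scale M" and res: "injective_resolution scale M d I \<eta> f"
    and y: "\<And>k. y (Suc (Suc k)) = F (y k)" "y 0 \<le> y 1" "y 1 \<le> F (y 0)"
  shows "exact_at M (carrier M) (y d) (y (Suc d)) (y (Suc (Suc d)))"
proof -
  have inj: "injective_module scale (I j)" if "j \<le> d" for j
    using res that by (simp add: injective_resolution_def)
  have fd: "fd_module scale (I j)" if "j \<le> d" for j
    using inj[OF that] by (simp add: injective_module_def)
  have y_le: "y k \<le> y (Suc k) \<and> y (Suc k) \<le> F (y k)" for k
    by (induction k) (use y monoD[OF F_mono] in auto)
  \<comment> \<open>The induction starts at the right end, where the kernel of \<open>f d\<close> is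
    all of \<open>I d\<close>; each step to the left in the injective resolution costs one degree in
    \<open>y\<close>.\<close>
  have "exact_at (I (d - q)) {v \<in> carrier (I (d - q)). f (d - q) v = 0} (y q) (y (Suc q)) (y (Suc (Suc q)))"
    if "q \<le> d" for q
    using that
  proof (induction q)
    case 0
    have "{v \<in> carrier (I d). f d v = 0} = carrier (I d)"
      using res by (auto simp: injective_resolution_def)
    then show ?case using injective_exact[OF inj[OF order_refl] y(2,3)] y(1) by simp
  next
    case (Suc q)
    define j where "j = d - Suc q"
    have j: "Suc j = d - q" "j < d" using Suc.prems by (auto simp: j_def)
    have "mod_hom (I j) (I (Suc j)) (f j)"
      "f j ` carrier (I j) = {v \<in> carrier (I (Suc j)). f (Suc j) v = 0}"
      using res j(2) by (auto simp: injective_resolution_def)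
    moreover have "exact_at (I (Suc j)) {v \<in> carrier (I (Suc j)). f (Suc j) v = 0}
        (y q) (y (Suc q)) (F (y q))"
      using Suc j(1) y(1) by simp
    ultimately show ?case
      using exact_shift[of "I j" "I (Suc j)" "f j" _ "y q" "y (Suc q)"] inj[of j] fd[of "Suc j"] j(2)
        y_le[of q] y(1) unfolding j_def[symmetric] by simp
  qed
  from this[OF order_refl]
  have ex: "exact_at (I 0) {v \<in> carrier (I 0). f 0 v = 0} (y d) (y (Suc d)) (y (Suc (Suc d)))" by simp
  have \<eta>: "mod_hom M (I 0) \<eta>" "inj_on \<eta> (carrier M)" "\<eta> ` carrier M = {v \<in> carrier (I 0). f 0 v = 0}"
    using res by (auto simp: injective_resolution_def)
  show ?thesis unfolding exact_at_def
  proof (intro ballI impI; elim conjE)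
    fix v assume v: "v \<in> carrier M" "act M v (pth (y (Suc d)) 0) = v"
      "act M v (pth (y (Suc d)) (nat (y (Suc (Suc d)) - y (Suc d)))) = 0"
    have \<eta>v: "\<eta> v \<in> {v \<in> carrier (I 0). f 0 v = 0}" using v(1) \<eta>(3) by blast
    have act_\<eta>v: "act (I 0) (\<eta> v) (pth (y (Suc d)) 0) = \<eta> v"
      "act (I 0) (\<eta> v) (pth (y (Suc d)) (nat (y (Suc (Suc d)) - y (Suc d)))) = 0"
      using hom_act[OF \<eta>(1) v(1), symmetric] v hom_zero[OF M \<eta>(1)] by simp_all
    obtain u where u: "u \<in> {v \<in> carrier (I 0). f 0 v = 0}" "act (I 0) u (pth (y d) 0) = u"
      "act (I 0) u (pth (y d) (nat (y (Suc d) - y d))) = \<eta> v"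
      by (rule exact_atE[OF ex \<eta>v act_\<eta>v])
    have "u \<in> \<eta> ` carrier M" unfolding \<eta>(3) by (rule u(1))
    then obtain w where w: "w \<in> carrier M" "\<eta> w = u" by blast
    have "\<eta> (act M w (pth (y d) 0)) = \<eta> w" "\<eta> (act M w (pth (y d) (nat (y (Suc d) - y d)))) = \<eta> v"
      using hom_act[OF \<eta>(1) w(1)] u w(2) by simp_all
    then have "act M w (pth (y d) 0) = w" "act M w (pth (y d) (nat (y (Suc d) - y d))) = v"
      using inj_onD[OF \<eta>(2)] act_closed[OF M w(1)] w(1) v(1) by blast+
    with w(1) show "\<exists>u\<in>carrier M. act M u (pth (y d) 0) = u \<and>
        act M u (pth (y d) (nat (y (Suc d) - y d))) = v" by blast
  qed
qed

section \<open>Simple modules as obstructions to short resolutions\<close>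

lemma pth_bounded: obtains B where "\<And>t l. l \<ge> B \<Longrightarrow> pth t l = 0"
proof -
  define B where "B = Max (dim_proj scale \<pi> ` verts n)"
  have "pth t l = 0" if "l \<ge> B" for t l
  proof (rule pth_zero)
    have "dim_proj scale \<pi> (vx n t) \<le> B"
      unfolding B_def by (intro Max_ge imageI vx_in_verts n_ge1) (simp add: verts_def)
    then show "F t \<le> t + int l" using that by (simp add: F_def)
  qed
  then show thesis using that by blast
qed

text \<open>The elements killed by all paths of positive length form a submodule, which contains
  \<open>v x\<close> for a longest path \<open>x\<close> with \<open>v x \<noteq> 0\<close>.\<close>

lemma simple_radical_zero:
  assumes S: "simple_module scale S" and v: "v \<in> carrier S" and l: "l \<ge> 1"
  shows "act S v (pth t l) = 0"
proof -
  have fd: "fd_module scale S" using S by (simp add: simple_module_def)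
  define N where "N = {v \<in> carrier S. \<forall>t. \<forall>l\<ge>1. act S v (pth t l) = 0}"
  note sub = carrier_subspace[OF fd]
  have "seq.subspace N" unfolding seq.subspace_def N_def
    by (auto simp: carrier_0[OF fd] act_zero[OF fd] act_add[OF fd] act_scale[OF fd]
        intro: seq.subspace_add[OF sub] seq.subspace_scale[OF sub])
  moreover have "act S v x \<in> N" if "v \<in> N" for v x
  proof -
    have v: "v \<in> carrier S" using that by (simp add: N_def)
    have "act S v (x * pth t l) = 0" if l: "l \<ge> 1" for t l
    proof (induction x rule: alg_induct)
      case (path s m)
      then show ?case using \<open>v \<in> N\<close> l by (auto simp: pth_mult act_zero_right[OF fd v] N_def)
    qed (simp_all add: distrib_right scale_mult act_add_right[OF fd v] act_scale_right[OF fd v])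
    then show ?thesis using act_closed[OF fd v] by (simp add: N_def act_mult[OF fd v])
  qed
  moreover have "N \<noteq> {0}"
  proof -
    obtain v where v: "v \<in> carrier S" "v \<noteq> 0" using S carrier_0[OF fd] by (auto simp: simple_module_def)
    obtain B where B: "\<And>t l. l \<ge> B \<Longrightarrow> pth t l = 0" using pth_bounded by blast
    have bd: "l \<le> B" if "\<exists>t. act S v (pth t l) \<noteq> 0" for l
      using that B[of l] act_zero_right[OF fd v(1)] by (metis nat_le_linear)
    have "\<exists>t. act S v (pth t 0) \<noteq> 0"
    proof (rule ccontr)
      assume "\<nexists>t. act S v (pth t 0) \<noteq> 0"
      then have "act S v 1 = 0" unfolding one_sum by (simp add: act_sum_right[OF fd v(1)])
      then show False using act_one[OF fd v(1)] v(2) by simp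
    qed
    then obtain l where l: "\<exists>t. act S v (pth t l) \<noteq> 0"
      "\<And>m. \<exists>t. act S v (pth t m) \<noteq> 0 \<Longrightarrow> m \<le> l"
      using GreatestI_nat[of "\<lambda>l. \<exists>t. act S v (pth t l) \<noteq> 0" 0 B]
        Greatest_le_nat[of "\<lambda>l. \<exists>t. act S v (pth t l) \<noteq> 0" _ B] bd by blast
    obtain t where t: "act S v (pth t l) \<noteq> 0" using l(1) by blast
    have "act S v (pth t (l + m)) = 0" if "m \<ge> 1" for m
      using l(2)[of "l + m"] that by auto
    then have "act S v (pth t l) \<in> N"
      using act_closed[OF fd v(1)] by (auto simp: N_def act_pth[OF fd v(1)])
    with t show ?thesis by blast
  qed
  ultimately have "N = carrier S" using S unfolding simple_module_def by (metis (no_types, lifting) N_def mem_Collect_eq subsetI)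
  then show ?thesis using v l by (auto simp: N_def)
qed

text \<open>Paths of positive length act as zero on \<open>S\<close>, so both maps of the complex
  vanish while its middle term \<open>S e_j\<close> does not.\<close>

lemma simple_not_exact:
  assumes S: "simple_at scale \<pi> (vx n j) S" and ij: "i < j" "j < k"
  shows "\<not> exact_at S (carrier S) i j k"
proof
  assume ex: "exact_at S (carrier S) i j k"
  have sm: "simple_module scale S" using S by (simp add: simple_at_def)
  then have fd: "fd_module scale S" by (simp add: simple_module_def)
  obtain w where w: "w \<in> carrier S" "act S w (pth j 0) \<noteq> 0"
    using S unfolding simple_at_def idem_pth by blast
  let ?v = "act S w (pth j 0)"
  have v: "?v \<in> carrier S" using w(1) by (rule act_closed[OF fd])
  have "act S ?v (pth j 0) = ?v" by (simp add: act_pth[OF fd w(1)])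
  moreover have "act S ?v (pth j (nat (k - j))) = 0" using ij by (intro simple_radical_zero[OF sm v]) auto
  ultimately obtain u where "u \<in> carrier S" "act S u (pth i (nat (j - i))) = ?v"
    using exact_atE[OF ex v] by blast
  then show False using simple_radical_zero[OF sm, of u "nat (j - i)" i] ij w(2) by simp
qed

text \<open>A \<open>k\<close> with \<open>F^m k < t < F^(m+1) k\<close> yields a test interval with
  nonzero \<open>Ext^(d+1)\<close> into \<open>S\<close>: its endpoints are \<open>k\<close> and a
  preimage of the cyclic \<open>t\<close>, and degrees \<open>d\<close>, \<open>d + 1\<close>,
  \<open>d + 2\<close> of its resolution sit at \<open>F^m k\<close>, \<open>t\<close>,
  \<open>F^(m+1) k\<close>. The parity of \<open>d\<close> decides which endpoint is
  \<open>k\<close>. The rounding in \<open>d div 2\<close> later excludes odd dimensions.\<close>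

lemma resolution_cosyz_zero:
  assumes S: "simple_at scale \<pi> (vx n t) S" and t: "per t"
    and res: "injective_resolution scale S d I \<eta> f"
  shows "cosyz_zero (d div 2) t"
  unfolding cosyz_zero_def
proof (intro allI impI, rule ccontr)
  fix k
  define m where "m = d div 2"
  assume "t < (F ^^ Suc (d div 2)) k" "\<not> t \<le> (F ^^ (d div 2)) k"
  then have k: "t < (F ^^ Suc m) k" "(F ^^ m) k < t" by (auto simp: m_def)
  have fd: "fd_module scale S" using S by (simp add: simple_at_def simple_module_def)
  have False if y01: "y0 \<le> y1" "y1 \<le> F y0" and
    yd: "if even d then (F ^^ m) y1 = t \<and> y0 = k else (F ^^ Suc m) y0 = t \<and> y1 = k" for y0 y1
  proof -
    define y where "y q = (F ^^ (q div 2)) (if even q then y0 else y1)" for q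
    have "exact_at S (carrier S) (y d) (y (Suc d)) (y (Suc (Suc d)))"
      by (rule resolution_exact[OF fd res]) (use y01 in \<open>auto simp: y_def\<close>)
    moreover have "y (Suc d) = t" "y d < t" "t < y (Suc (Suc d))"
      using yd k by (auto simp: y_def m_def split: if_splits elim!: evenE oddE)
    ultimately show False using simple_not_exact[of "y (Suc d)"] S by blast
  qed
  moreover have "\<exists>y0 y1. y0 \<le> y1 \<and> y1 \<le> F y0 \<and>
    (if even d then (F ^^ m) y1 = t \<and> y0 = k else (F ^^ Suc m) y0 = t \<and> y1 = k)"
  proof (cases "even d")
    case True
    obtain y1 where y1: "(F ^^ m) y1 = t" using per_preimage[OF t] by blast
    have "k \<le> y1" using Fp_mono[of y1 k m] k(2) y1 by linarith
    moreover have "y1 \<le> F k"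
      using Fp_mono[of "F k" y1 m] k(1) y1 unfolding funpow_Suc_right comp_apply by linarith
    ultimately show ?thesis using True y1 by auto
  next
    case False
    obtain y0 where y0: "(F ^^ Suc m) y0 = t" using per_preimage[OF t] by blast
    have "y0 \<le> k" using Fp_mono[of k y0 "Suc m"] k(1) y0 by linarith
    moreover have "k \<le> F y0"
      using Fp_mono[of "F y0" k m] k(2) y0 unfolding funpow_Suc_right comp_apply by linarith
    ultimately show ?thesis using False y0 by auto
  qed
  ultimately show False by blast
qed

subsection \<open>Upper bound for the injective dimension\<close>

text \<open>The least \<open>i\<close> with \<open>j \<le> F i\<close>: \<open>j\<close> itself
  qualifies, and translating down by a large multiple of \<open>n\<close> takes \<open>F\<close>
  below \<open>j\<close>.\<close>

lemma ex_lower: "\<exists>i. j \<le> F i \<and> F (i - 1) < j"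
proof -
  define k where "k = (LEAST k. F (j - int k - 1) < j)"
  define u where "u = nat \<bar>F j - j\<bar> + 1"
  have "int u \<le> int (n * u)"
    unfolding of_nat_le_iff using mult_le_mono1[OF n_ge1, of u] by (simp only: mult_1_left)
  moreover have "F j - j < int u" by (simp add: u_def)
  ultimately have "F (j + int n * - int u) < j" unfolding F_add_mult by simp
  moreover have "F (j - int (n * u) - 1) \<le> F (j + int n * - int u)"
    by (rule monoD[OF F_mono]) simp
  ultimately have "F (j - int (n * u) - 1) < j" by simp
  then have k: "F (j - int k - 1) < j" unfolding k_def by (rule LeastI)
  have "j \<le> F (j - int k)"
  proof (cases k)
    case 0
    then show ?thesis using F_gt[of j] by simp
  next
    case (Suc k')
    then have "\<not> F (j - int k' - 1) < j"
      using not_less_Least[of k' "\<lambda>k. F (j - int k - 1) < j"] by (simp add: k_def)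
    moreover have "j - int k' - 1 = j - int k" by (simp add: Suc)
    ultimately show ?thesis by simp
  qed
  with k show ?thesis by blast
qed

definition G :: "int \<Rightarrow> int" where
  "G j = (SOME i. j \<le> F i \<and> F (i - 1) < j)"

lemma G: "j \<le> F (G j)" "F (G j - 1) < j"
  using someI_ex[OF ex_lower, of j] unfolding G_def by auto

lemma G_le_iff: "G j \<le> i \<longleftrightarrow> j \<le> F i"
proof
  assume "G j \<le> i"
  then show "j \<le> F i" using G(1)[of j] monoD[OF F_mono] by (meson order_trans)
next
  assume "j \<le> F i"
  then show "G j \<le> i" using G(2)[of j] monoD[OF F_mono, of i "G j - 1"] by linarith
qed

lemma Gp_le_iff: "(G ^^ m) j \<le> i \<longleftrightarrow> j \<le> (F ^^ m) i"
proof (induction m arbitrary: i)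
  case (Suc m)
  have "(G ^^ Suc m) j \<le> i \<longleftrightarrow> (G ^^ m) j \<le> F i" by (simp add: G_le_iff)
  also have "\<dots> \<longleftrightarrow> j \<le> (F ^^ Suc m) i" unfolding Suc funpow_Suc_right by simp
  finally show ?case .
qed simp

lemma interval_simple: "simple_at scale \<pi> (vx n t) (interval t (t + 1))"
proof -
  let ?S = "interval t (t + 1)"
  have Ft: "t + 1 \<le> F t" using F_gt[of t] by simp
  have e: "unit_seq t \<in> carrier ?S" by (auto intro: unit_seq_in)
  have e0: "unit_seq t \<noteq> 0" using unit_seq_apply[of t t] by (auto simp: zero_fun_apply)
  have "N = {0} \<or> N = carrier ?S" if N: "N \<subseteq> carrier ?S" "seq.subspace N" for N
  proof (cases "N \<subseteq> {0}")
    case True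
    then show ?thesis using seq.subspace_0[OF N(2)] by blast
  next
    case False
    then obtain w where w: "w \<in> N" "w \<noteq> 0" by blast
    have eq: "v = seq_scale (v (int_encode t) / w (int_encode t)) w" if "v \<in> carrier ?S" for v
    proof (rule seq_eqI)
      have w_other: "w (int_encode s) = 0" if "s \<noteq> t" for s
        using interval_carrier_zero[of w t "t + 1" s] w(1) N(1) that by auto
      have w_t: "w (int_encode t) \<noteq> 0"
      proof
        assume "w (int_encode t) = 0"
        then have "w = 0" using w_other by (intro seq_eqI) (metis zero_fun_apply)
        with w(2) show False ..
      qed
      fix s
      show "v (int_encode s) = seq_scale (v (int_encode t) / w (int_encode t)) w (int_encode s)"
        using w_t w_other interval_carrier_zero[OF that, of s]
        by (cases "s = t") (auto simp: seq_scale_apply)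
    qed
    have "v \<in> N" if "v \<in> carrier ?S" for v
      using eq[OF that] seq.subspace_scale[OF N(2) w(1)] by metis
    then show ?thesis using N(1) by blast
  qed
  then have "simple_module scale ?S"
    unfolding simple_module_def using interval_fd_module[OF Ft] e e0 by blast
  moreover have "act ?S (unit_seq t) (pth t 0) = unit_seq t"
  proof (rule seq_eqI)
    fix s
    show "act ?S (unit_seq t) (pth t 0) (int_encode s) = unit_seq t (int_encode s)"
      by (auto simp: interval_act_pth[OF Ft] unit_seq_apply)
  qed
  ultimately show ?thesis unfolding simple_at_def idem_pth using e e0 by metis
qed

text \<open>The minimal injective resolution: the cosyzygy of \<open>interval j i\<close> in its injective hull
  \<open>interval (G i) i\<close> is \<open>interval (G i) j\<close>.\<close>

lemma cosyz_zero_resolution: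
  assumes c: "cosyz_zero m t"
  shows "\<exists>I \<eta> f. injective_resolution scale (interval t (t + 1)) (2 * m) I \<eta> f"
proof -
  \<comment> \<open>The sequence \<open>t + 1, t, G (t + 1), G t, ...\<close>: injective terms are
    \<open>[z (k + 2), z k)\<close> and cosyzygies \<open>[z (k + 1), z k)\<close>.\<close>
  define z where "z k = (G ^^ (k div 2)) (if even k then t + 1 else t)" for k
  have z0: "z 0 = t + 1" "z 1 = t" and zS: "z (Suc (Suc k)) = G (z k)" for k
    by (simp_all add: z_def)
  have z_le: "z (Suc k) \<le> z k \<and> z (Suc (Suc k)) \<le> z (Suc k)" for k
  proof (induction k)
    case 0
    then show ?case using F_gt[of t] z0 zS[of 0] by (simp add: G_le_iff)
  next
    case (Suc k)
    have "z (Suc k) \<le> F (z (Suc (Suc k)))"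
      using Suc G(1)[of "z k"] zS[of k] by simp
    then show ?case using Suc zS[of "Suc k"] by (simp add: G_le_iff)
  qed
  \<comment> \<open>The cosyzygy of degree \<open>2 * m + 1\<close> is empty, so
    \<open>I (2 * m)\<close> coincides with the cosyzygy of degree \<open>2 * m\<close> and the
    resolution stops.\<close>
  have zend: "z (Suc (2 * m)) = z (Suc (Suc (2 * m)))"
  proof (rule antisym)
    have "t + 1 \<le> (F ^^ Suc m) (z (Suc (Suc (2 * m))))"
      unfolding Gp_le_iff[symmetric] by (simp add: z_def)
    then have "t \<le> (F ^^ m) (z (Suc (Suc (2 * m))))" using c unfolding cosyz_zero_def by simp
    then show "z (Suc (2 * m)) \<le> z (Suc (Suc (2 * m)))"
      unfolding Gp_le_iff[symmetric] by (simp add: z_def)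
  qed (use z_le in blast)
  define I where "I k = interval (z (Suc (Suc k))) (z k)" for k
  \<comment> \<open>Forgetting the positions from \<open>z (Suc k)\<close> on is passing to the
    quotient by the cosyzygy of degree \<open>k\<close>.\<close>
  define f :: "nat \<Rightarrow> (nat \<Rightarrow> 'k) \<Rightarrow> (nat \<Rightarrow> 'k)"
    where "f k v = (\<lambda>q. if int_decode q < z (Suc k) then v q else 0)" for k v
  have f: "f k v (int_encode s) = (if s < z (Suc k) then v (int_encode s) else 0)" for k v s
    by (simp add: f_def)
  have zF: "z k \<le> F (z (Suc (Suc k)))" for k using G(1) zS by simp
  have inj: "injective_module scale (I k)" for k
    unfolding I_def
  proof (rule interval_injective)
    show "z (Suc (Suc k)) < z k"
      using G_le_iff[of "z k" "z k - 1"] F_gt[of "z k - 1"] zS[of k] by simp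
    show "F (z (Suc (Suc k)) - 1) < z k" using G(2)[of "z k"] zS by simp
  qed (rule zF)
  have fd: "fd_module scale (I k)" for k using inj by (simp add: injective_module_def)
  have zero_iff: "f k v = 0 \<longleftrightarrow> (\<forall>s < z (Suc k). v (int_encode s) = 0)" for k v
  proof
    assume f0: "f k v = 0"
    then have "f k v (int_encode s) = 0" for s by (simp add: zero_fun_apply)
    then show "\<forall>s < z (Suc k). v (int_encode s) = 0" unfolding f by metis
  next
    assume "\<forall>s < z (Suc k). v (int_encode s) = 0"
    then show "f k v = 0" by (intro seq_eqI) (simp add: f zero_fun_apply)
  qed
  have ker: "{v \<in> carrier (I k). f k v = 0} = carrier (interval (z (Suc k)) (z k))" for k
  proof
    show "{v \<in> carrier (I k). f k v = 0} \<subseteq> carrier (interval (z (Suc k)) (z k))"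
      unfolding zero_iff I_def interval_carrier Collect_mono_iff subset_iff mem_Collect_eq
      by (meson not_less)
    show "carrier (interval (z (Suc k)) (z k)) \<subseteq> {v \<in> carrier (I k). f k v = 0}"
      unfolding zero_iff I_def interval_carrier subset_iff mem_Collect_eq
      using z_le[of k] by (meson not_less order_trans)
  qed
  have hom: "mod_hom (I k) (I (Suc k)) (f k)" for k
  proof (rule mod_homI[OF fd fd])
    fix v assume v: "v \<in> carrier (I k)"
    show "f k v \<in> carrier (I (Suc k))"
      using v z_le[of k] z_le[of "Suc k"] unfolding I_def interval_carrier f by force
    show "f k (v + w) = f k v + f k w" for w by (rule seq_eqI) (simp add: f seq_apply)
    show "f k (seq_scale c v) = seq_scale c (f k v)" for c by (rule seq_eqI) (simp add: f seq_apply)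
    show "f k (act (I k) v (pth c l)) = act (I (Suc k)) (f k v) (pth c l)" for c l
    proof (rule seq_eqI)
      fix s
      show "f k (act (I k) v (pth c l)) (int_encode s) = act (I (Suc k)) (f k v) (pth c l) (int_encode s)"
        using z_le[of k] z_le[of "Suc k"] interval_carrier_zero[OF v[unfolded I_def], of "s - int l"]
        unfolding f I_def interval_act_pth[OF zF] by auto
    qed
  qed
  have im: "f k ` carrier (I k) = {v \<in> carrier (I (Suc k)). f (Suc k) v = 0}" for k
    unfolding ker
  proof
    show "f k ` carrier (I k) \<subseteq> carrier (interval (z (Suc (Suc k))) (z (Suc k)))"
    proof safe
      fix v assume "v \<in> carrier (I k)"
      then show "f k v \<in> carrier (interval (z (Suc (Suc k))) (z (Suc k)))"
        unfolding I_def interval_carrier f by (simp split: if_splits)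
    qed
    show "carrier (interval (z (Suc (Suc k))) (z (Suc k))) \<subseteq> f k ` carrier (I k)"
    proof
      fix v assume v: "v \<in> carrier (interval (z (Suc (Suc k))) (z (Suc k)))"
      then have "v = f k v" by (intro seq_eqI) (auto simp: f interval_carrier)
      moreover have "v \<in> carrier (I k)"
        using v z_le[of k] unfolding I_def interval_carrier by force
      ultimately show "v \<in> f k ` carrier (I k)" by (rule image_eqI)
    qed
  qed
  have \<eta>: "mod_hom (interval t (t + 1)) (I 0) (\<lambda>v. v)"
    unfolding I_def using zF[of 0] z_le[of 0] z0 by (simp add: interval_inclusion)
  have "injective_resolution scale (interval t (t + 1)) (2 * m) I (\<lambda>v. v) f"
    unfolding injective_resolution_def
  proof (intro conjI allI impI ballI)
    fix v assume v: "v \<in> carrier (I (2 * m))"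
    have "v \<in> {v \<in> carrier (I (2 * m)). f (2 * m) v = 0}"
      unfolding ker zend using v by (simp add: I_def)
    then show "f (2 * m) v = 0" by simp
  next
    show "(\<lambda>v. v) ` carrier (interval t (t + 1)) = {v \<in> carrier (I 0). f 0 v = 0}"
      unfolding ker using z0 by simp
  qed (use inj hom im \<eta> in auto)
  then show ?thesis by blast
qed

lemma even_dimension_iff:
  "(\<exists>a S d. cyclic_vertex n (dim_proj scale \<pi>) a \<and> simple_at scale \<pi> a S \<and>
      injective_dimension scale S = enat d \<and> even d) \<longleftrightarrow>
   (res_connected n (dim_proj scale \<pi>) \<and> res_weight n (dim_proj scale \<pi>) = 1)"
  (is "?L \<longleftrightarrow> ?R")
proof
  \<comment> \<open>The infimum of the empty set is infinite, and a nonempty set of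
    \<open>enat\<close> contains its infimum, so a finite dimension is attained.\<close>
  have dim: "\<exists>I \<eta> f. injective_resolution scale S d I \<eta> f" if "injective_dimension scale S = enat d" for S d
  proof -
    let ?D = "{enat d | d. \<exists>I \<eta> f. injective_resolution scale S d I \<eta> f}"
    have "?D \<noteq> {}" using that unfolding injective_dimension_def Inf_enat_def by (auto split: if_splits)
    then have "Inf ?D \<in> ?D" unfolding Inf_enat_def using LeastI_ex[of "\<lambda>x. x \<in> ?D"] by auto
    then show ?thesis using that unfolding injective_dimension_def by auto
  qed
  have dim_le: "injective_dimension scale S \<le> enat d" if "injective_resolution scale S d I \<eta> f" for S d I \<eta> f
    unfolding injective_dimension_def using that by (intro Inf_lower) blast
  {
    assume ?L
    then obtain a S d where a: "cyclic_vertex n (dim_proj scale \<pi>) a" "simple_at scale \<pi> a S"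
      "injective_dimension scale S = enat d" by blast
    have va: "vx n (int a) = a" using a(1) vx_of_nat by (auto simp: cyclic_vertex_def)
    then have "per (int a)" using a(1) cyclic_vx_iff[of "int a"] by simp
    moreover from this have "cosyz_zero (d div 2) (int a)"
      using resolution_cosyz_zero[of "int a"] va a(2) dim[OF a(3)] by auto
    ultimately show ?R using connected_weight_one by blast
  }
  {
    assume ?R
    then obtain t m where t: "per t" "cosyz_zero m t" using ex_cosyz_zero by blast
    let ?S = "interval t (t + 1)"
    obtain d where d: "injective_dimension scale ?S = enat d"
      using cosyz_zero_resolution[OF t(2)] dim_le by (metis enat_ile)
    \<comment> \<open>A resolution of length \<open>d\<close> yields one of length
      \<open>2 * (d div 2)\<close>, so minimality of \<open>d\<close> makes it even.\<close>
    have "cosyz_zero (d div 2) t"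
      using resolution_cosyz_zero[OF interval_simple t(1)] dim[OF d] by blast
    then have "enat d \<le> enat (2 * (d div 2))"
      using cosyz_zero_resolution dim_le d by metis
    then have "even d" by simp presburger
    moreover have "cyclic_vertex n (dim_proj scale \<pi>) (vx n t)" using t(1) cyclic_vx_iff by simp
    ultimately show ?L using d interval_simple[of t] by (intro exI conjI)
  }
qed

end

theorem mainTheorem3:
  fixes n :: nat
    and R :: "(nat \<times> nat) set"
    and scale :: "'k::field \<Rightarrow> 'a::ring_1 \<Rightarrow> 'a"
    and \<pi> :: "(nat \<times> nat \<Rightarrow> 'k) \<Rightarrow> 'a"
  assumes "nakayama_algebra n R scale \<pi>"
  shows "(\<exists>a S d. cyclic_vertex n (dim_proj scale \<pi>) a \<and> simple_at scale \<pi> a S \<and>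
            injective_dimension scale S = enat d \<and> even d) \<longleftrightarrow>
         (res_connected n (dim_proj scale \<pi>) \<and> res_weight n (dim_proj scale \<pi>) = 1)"
proof -
  interpret nakayama n R scale \<pi> using assms by unfold_locales
  show ?thesis by (rule even_dimension_iff)
qed

end
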